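(* Let $\mathsf k$ be a field and let $Q$, $R$ and $S$ be graded Gorenstein Artin $\mathsf k$-algebras with $\ell\ell(Q)=\ell\ell(R)=\ell\ell(S)\geq 3$. Suppose $\overline Q\simeq\overline R\times_{\mathsf k}\overline S$ as graded rings, where $\overline Q=Q/\operatorname{soc}(Q)$, $\overline R=R/\operatorname{soc}(R)$ and $\overline S=S/\operatorname{soc}(S)$. Then $Q$ can be decomposed as a connected sum over $\mathsf k$.
   Context: A graded $\mathsf k$-algebra is a graded ring $G=\bigoplus_{i\ge0}G_i$ with $G_0=\mathsf k$; its maximal ideal is $\bigoplus_{i\ge1}G_i$, and when Artinian it is local with residue field $\mathsf k$. $\ell\ell(T)=\max\{n:\mathfrak m_T^n\neq 0\}$ is the Loewy length of an Artinian local ring $T$. Fibre product: for local rings $(R,\mathfrak m_R,\mathsf k)$, $(S,\mathfrak m_S,\mathsf k)$ with natural projections $\pi_R,\pi_S$ onto $\mathsf k$, $R\times_{\mathsf k}S=\{(r,s)\in R\times S:\pi_R(r)=\pi_S(s)\}$. Connected sum: if $R,S$ are Gorenstein Artin local rings with residue field $\mathsf k$, different from $\mathsf k$, and $\operatorname{soc}(R)=\langle\delta_R\rangle$, $\operatorname{soc}(S)=\langle\delta_S\rangle$, then $R\#_{\mathsf k}S=(R\times_{\mathsf k}S)/\langle(\delta_R,0)-(0,\delta_S)\rangle$. It depends on the chosen socle generators; $Q\simeq R\#_{\mathsf k}S$ means that this holds for some choice. A Gorenstein Artin local ring $(Q,\mathfrak m_Q,\mathsf k)$ decomposes (non-trivially)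 as a connected sum over $\mathsf k$ if there are Gorenstein Artin local rings $R',S'$ with residue field $\mathsf k$ and $\ell\ell(R'),\ell\ell(S')\ge 2$ such that $Q\simeq R'\#_{\mathsf k}S'$ and $R'\not\simeq Q\not\simeq S'$ (the last condition is automatic by length). *)

theory Defs
  imports "HOL-Algebra.Algebra"
begin

section \<open>Gorenstein Artin local rings\<close>

text \<open>All rings are commutative with unit, and local rings are nonzero: a maximal ideal is
  proper.\<close>

definition local_ring :: "('a, 'm) ring_scheme \<Rightarrow> bool" where
  "local_ring R \<longleftrightarrow> cring R \<and> (\<exists>!M. maximalideal M R)"

definition max_ideal :: "('a, 'm) ring_scheme \<Rightarrow> 'a set" where
  "max_ideal R = (THE M. maximalideal M R)"

definition artinian_ring :: "('a, 'm) ring_scheme \<Rightarrow> bool" where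
  "artinian_ring R \<longleftrightarrow> cring R \<and>
     (\<forall>I :: nat \<Rightarrow> 'a set. (\<forall>n. ideal (I n) R \<and> I (Suc n) \<subseteq> I n) \<longrightarrow> (\<exists>N. \<forall>n\<ge>N. I n = I N))"

definition socle :: "('a, 'm) ring_scheme \<Rightarrow> 'a set" where
  "socle R = {x \<in> carrier R. \<forall>y \<in> max_ideal R. x \<otimes>\<^bsub>R\<^esub> y = \<zero>\<^bsub>R\<^esub>}"

text \<open>The socle is a vector space over the residue field, and its linear subspaces are the ideals
  it contains. Hence the last clause says that the socle is one-dimensional, which is what being
  Gorenstein means for an Artinian local ring.\<close>

definition gorenstein_artin_local :: "('a, 'm) ring_scheme \<Rightarrow> bool" where
  "gorenstein_artin_local R \<longleftrightarrow> local_ring R \<and> artinian_ring R \<and>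
     (\<exists>\<delta> \<in> carrier R. \<delta> \<noteq> \<zero>\<^bsub>R\<^esub> \<and> socle R = PIdl\<^bsub>R\<^esub> \<delta>)"

text \<open>\<^const>\<open>ideals_set\<close> \<open>R\<close> is the semiring of ideals of \<open>R\<close>; its unit, hence the zeroth power
  of the maximal ideal, is the whole ring.\<close>

definition loewy_length :: "('a, 'm) ring_scheme \<Rightarrow> nat" where
  "loewy_length R = Max {n :: nat. max_ideal R [^]\<^bsub>ideals_set R\<^esub> n \<noteq> {\<zero>\<^bsub>R\<^esub>}}"


section \<open>Fibre products and connected sums\<close>

text \<open>A local ring has residue field \<open>K\<close> when it comes with a surjection onto \<open>K\<close>; the kernel of
  such a map is necessarily the maximal ideal.\<close>

definition residue_map ::
  "('k, 'l) ring_scheme \<Rightarrow> ('a, 'm) ring_scheme \<Rightarrow> ('a \<Rightarrow> 'k) \<Rightarrow> bool" where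
  "residue_map K R \<pi> \<longleftrightarrow> \<pi> \<in> ring_hom R K \<and> \<pi> ` carrier R = carrier K"

definition fibre_product ::
  "('a, 'm) ring_scheme \<Rightarrow> ('a \<Rightarrow> 'k) \<Rightarrow> ('b, 'n) ring_scheme \<Rightarrow> ('b \<Rightarrow> 'k) \<Rightarrow> ('a \<times> 'b) ring" where
  "fibre_product R \<pi>\<^sub>R S \<pi>\<^sub>S =
     (RDirProd R S) \<lparr> carrier := {(r, s). r \<in> carrier R \<and> s \<in> carrier S \<and> \<pi>\<^sub>R r = \<pi>\<^sub>S s} \<rparr>"

definition connected_sum ::
  "('a, 'm) ring_scheme \<Rightarrow> ('a \<Rightarrow> 'k) \<Rightarrow> 'a \<Rightarrow> ('b, 'n) ring_scheme \<Rightarrow> ('b \<Rightarrow> 'k) \<Rightarrow> 'b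
     \<Rightarrow> ('a \<times> 'b) set ring" where
  "connected_sum R \<pi>\<^sub>R \<delta>\<^sub>R S \<pi>\<^sub>S \<delta>\<^sub>S =
     (let P = fibre_product R \<pi>\<^sub>R S \<pi>\<^sub>S
      in P Quot (PIdl\<^bsub>P\<^esub> ((\<delta>\<^sub>R, \<zero>\<^bsub>S\<^esub>) \<ominus>\<^bsub>P\<^esub> (\<zero>\<^bsub>R\<^esub>, \<delta>\<^sub>S))))"

text \<open>\<open>Q\<close> is a connected sum of \<open>R\<close> and \<open>S\<close> over \<open>K\<close>, for some choice of socle generators and some
  identification of the residue fields with \<open>K\<close>. As the residue field is \<open>K\<close>, a nonzero maximal
  ideal means that the ring is different from \<open>K\<close>.\<close>

definition is_connected_sum ::
  "('k, 'l) ring_scheme \<Rightarrow> ('q, 'o) ring_scheme \<Rightarrow> ('a, 'm) ring_scheme \<Rightarrow> ('b, 'n) ring_scheme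
     \<Rightarrow> bool" where
  "is_connected_sum K Q R S \<longleftrightarrow>
     gorenstein_artin_local R \<and> gorenstein_artin_local S \<and>
     max_ideal R \<noteq> {\<zero>\<^bsub>R\<^esub>} \<and> max_ideal S \<noteq> {\<zero>\<^bsub>S\<^esub>} \<and>
     (\<exists>\<pi>\<^sub>R \<pi>\<^sub>S. \<exists>\<delta>\<^sub>R \<in> carrier R. \<exists>\<delta>\<^sub>S \<in> carrier S.
        residue_map K R \<pi>\<^sub>R \<and> residue_map K S \<pi>\<^sub>S \<and>
        socle R = PIdl\<^bsub>R\<^esub> \<delta>\<^sub>R \<and> socle S = PIdl\<^bsub>S\<^esub> \<delta>\<^sub>S \<and>
        Q \<simeq> connected_sum R \<pi>\<^sub>R \<delta>\<^sub>R S \<pi>\<^sub>S \<delta>\<^sub>S)"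

text \<open>The two factors are sought on the type \<open>'q\<close> of \<open>Q\<close>. This loses nothing: an Artinian local
  ring of length \<open>n\<close> with residue field \<open>K\<close> has the cardinality of \<open>K ^ n\<close>, and in a non-trivial
  decomposition the factors are shorter than \<open>Q\<close>, so they have isomorphic copies inside the
  carrier of \<open>Q\<close>.\<close>

definition decomposes_as_connected_sum :: "('k, 'l) ring_scheme \<Rightarrow> ('q, 'o) ring_scheme \<Rightarrow> bool" where
  "decomposes_as_connected_sum K Q \<longleftrightarrow>
     (\<exists>(R' :: 'q ring) (S' :: 'q ring).
        2 \<le> loewy_length R' \<and> 2 \<le> loewy_length S' \<and>
        is_connected_sum K Q R' S' \<and> \<not> R' \<simeq> Q \<and> \<not> S' \<simeq> Q)"


section \<open>Graded algebras\<close>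

text \<open>\<open>\<iota>\<close> identifies \<open>K\<close> with the degree \<open>0\<close> component. No generation in degree \<open>1\<close> is assumed.\<close>

locale graded_algebra = field K + G: cring G
  for K :: "('k, 'l) ring_scheme" and G :: "('a, 'm) ring_scheme" +
  fixes \<iota> :: "'k \<Rightarrow> 'a" and gr :: "nat \<Rightarrow> 'a set"
  assumes unit_hom: "\<iota> \<in> ring_hom K G"
    and unit_bij: "bij_betw \<iota> (carrier K) (gr 0)"
    and gr_subgroup: "\<And>i. additive_subgroup (gr i) G"
    and gr_mult: "\<And>i j x y. x \<in> gr i \<Longrightarrow> y \<in> gr j \<Longrightarrow> x \<otimes>\<^bsub>G\<^esub> y \<in> gr (i + j)"
    and gr_direct_sum: "\<And>x. x \<in> carrier G \<Longrightarrow>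
      \<exists>!f. (\<forall>i. f i \<in> gr i) \<and> finite {i. f i \<noteq> \<zero>\<^bsub>G\<^esub>} \<and>
           x = finsum G f {i. f i \<noteq> \<zero>\<^bsub>G\<^esub>}"

text \<open>The natural projection of a local \<open>K\<close>-algebra with residue field \<open>K\<close>: the class of \<open>x\<close> modulo
  the maximal ideal, read as a scalar.\<close>

definition residue_proj ::
  "('k, 'l) ring_scheme \<Rightarrow> ('a, 'm) ring_scheme \<Rightarrow> ('k \<Rightarrow> 'a) \<Rightarrow> 'a \<Rightarrow> 'k" where
  "residue_proj K R \<iota> x = (THE c. c \<in> carrier K \<and> x \<ominus>\<^bsub>R\<^esub> \<iota> c \<in> max_ideal R)"

definition quot_unit :: "('a, 'm) ring_scheme \<Rightarrow> 'a set \<Rightarrow> ('k \<Rightarrow> 'a) \<Rightarrow> 'k \<Rightarrow> 'a set" where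
  "quot_unit R I \<iota> c = I +>\<^bsub>R\<^esub> \<iota> c"

definition quot_grading :: "('a, 'm) ring_scheme \<Rightarrow> 'a set \<Rightarrow> (nat \<Rightarrow> 'a set) \<Rightarrow> nat \<Rightarrow> 'a set set" where
  "quot_grading R I gr i = (\<lambda>x. I +>\<^bsub>R\<^esub> x) ` gr i"

text \<open>For graded \<open>K\<close>-algebras this is the diagonal copy of \<open>K\<close> in degree \<open>0\<close>, and the product of the
  components in each positive degree, where both projections vanish.\<close>

definition fibre_grading ::
  "('a \<Rightarrow> 'k) \<Rightarrow> (nat \<Rightarrow> 'a set) \<Rightarrow> ('b \<Rightarrow> 'k) \<Rightarrow> (nat \<Rightarrow> 'b set) \<Rightarrow> nat \<Rightarrow> ('a \<times> 'b) set" where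
  "fibre_grading \<pi>\<^sub>R gr\<^sub>R \<pi>\<^sub>S gr\<^sub>S i = {(r, s). r \<in> gr\<^sub>R i \<and> s \<in> gr\<^sub>S i \<and> \<pi>\<^sub>R r = \<pi>\<^sub>S s}"

definition graded_ring_iso ::
  "('a, 'm) ring_scheme \<Rightarrow> (nat \<Rightarrow> 'a set) \<Rightarrow> ('b, 'n) ring_scheme \<Rightarrow> (nat \<Rightarrow> 'b set) \<Rightarrow> bool" where
  "graded_ring_iso A gr\<^sub>A B gr\<^sub>B \<longleftrightarrow> (\<exists>\<phi> \<in> ring_iso A B. \<forall>i. \<phi> ` gr\<^sub>A i = gr\<^sub>B i)"

end

theory Submission
  imports Defs
begin

text \<open>Write \<open>m\<close> for the maximal ideal of \<open>Q\<close>. The degree zero component \<open>k\<close> of \<open>Q\<close> is a coefficient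
field: \<open>Q = k + m\<close>, because homogeneous elements of positive degree are not units
(\<open>gorenstein_algebra_of_graded\<close>). Pulling back the maximal ideals of the two factors of the fibre
product along \<open>Q \<rightarrow> Q / soc Q\<close> gives ideals \<open>I\<close> and \<open>J\<close> of \<open>Q\<close>, both different from the socle, with
\<open>I + J = m\<close> and
\<open>I \<inter> J = soc Q\<close>. If in addition \<open>I J = 0\<close>, then \<open>Q\<close> is the connected sum of its subrings \<open>k + I\<close> and
\<open>k + J\<close>: the map \<open>(c + a, c + b) \<mapsto> c + a + b\<close> from their fibre product onto \<open>Q\<close> is a ring
homomorphism, and its kernel is generated by \<open>(\<delta>, - \<delta>)\<close> for a generator \<open>\<delta>\<close> of the socle
(\<open>is_connected_sum_of_orthogonal_ideals\<close>). The two subrings are Gorenstein with the same socle,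
because \<open>Q\<close> acts on \<open>I\<close> through \<open>k + I\<close>.

The hypothesis only gives \<open>I J \<subseteq> soc Q\<close>, and as \<open>Q\<close> need not be generated in degree one, the
product may be nonzero; then \<open>I\<close> or \<open>J\<close> has to be replaced. Duality does this. In a Gorenstein
algebra every ideal is the annihilator of its annihilator (\<open>double_annihilator\<close>). Hence an ideal \<open>A\<close>
with \<open>A \<inter> ann A = soc Q\<close> satisfies \<open>A + ann A = m\<close> (\<open>ideal_add_annihilator\<close>), and \<open>A\<close>, \<open>ann A\<close> is a
pair of the required kind as soon as neither ideal is the socle. Such an \<open>A\<close> is found by looking at
the annihilator \<open>D\<close> of \<open>m\<^sup>2\<close>.

\<^item> If \<open>D\<close> does not annihilate itself, one or two elements of \<open>D\<close> span, modulo the socle, a space on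
  which multiplication into the socle is a nondegenerate form. Together with the socle they form
  \<open>A\<close>, and \<open>A \<inter> ann A = soc Q\<close> says just that the form is nondegenerate
  (\<open>splitting_in_ann_sq\<close>).

\<^item> If \<open>D\<close> annihilates itself, \<open>A = I\<close> works (\<open>splitting_of_separated_ideals\<close>). An element \<open>x\<close> of
  \<open>I \<inter> ann I\<close> lies in \<open>D\<close>, hence in \<open>ann D\<close>, which duality places in \<open>I\<^sup>2 + J\<close>. As \<open>I\<^sup>2\<close> kills \<open>J\<close>, this
  forces \<open>x\<close> to kill \<open>J\<close> too, so that it is in the socle.

Duality itself is a count of dimensions over \<open>k\<close>. Adding to an ideal \<open>C\<close> a new element \<open>b\<close> with
\<open>m b \<subseteq> C\<close> raises its dimension by one, and lowers that of the annihilator by at most one, since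
multiplication by \<open>b\<close> maps \<open>ann C\<close> to the one-dimensional socle. Along a chain from \<open>0\<close> to \<open>Q\<close> all these
steps must be sharp.

No factor is isomorphic to \<open>Q\<close>: an isomorphism of \<open>Q\<close> onto \<open>k + I\<close>, iterated on \<open>m\<close>, would produce a
strictly decreasing sequence of ideals of \<open>Q\<close>.\<close>

section \<open>Local and Artinian rings\<close>

lemma (in cring) ideal_by_closure:
  assumes "B \<subseteq> carrier R" "B \<noteq> {}"
    and add: "\<And>a b. a \<in> B \<Longrightarrow> b \<in> B \<Longrightarrow> a \<oplus> b \<in> B"
    and mult: "\<And>a t. a \<in> B \<Longrightarrow> t \<in> carrier R \<Longrightarrow> t \<otimes> a \<in> B"
  shows "ideal B R"
proof (rule idealI)
  have carr: "\<And>a. a \<in> B \<Longrightarrow> a \<in> carrier R" using assms(1) by blast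
  show "ring R" by (rule ring_axioms)
  show "subgroup B (add_monoid R)"
  proof (rule add.subgroupI[OF assms(1,2) _ add])
    fix a assume a: "a \<in> B"
    have "\<ominus> a = (\<ominus> \<one>) \<otimes> a" using carr[OF a] by algebra
    thus "\<ominus> a \<in> B" using mult[OF a, of "\<ominus> \<one>"] by simp
  qed
  fix a x assume a: "a \<in> B" and x: "x \<in> carrier R"
  show "x \<otimes> a \<in> B" by (rule mult[OF a x])
  thus "a \<otimes> x \<in> B" using m_comm[OF x carr[OF a]] by simp
qed

text \<open>Krull's theorem, from Zorn's lemma: the union of a chain of ideals that avoid \<open>\<one>\<close> is again such an
ideal.\<close>

lemma (in cring) proper_ideal_in_maximal:
  assumes I: "ideal I R" and one: "\<one> \<notin> I"
  shows "\<exists>M. maximalideal M R \<and> I \<subseteq> M"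
proof -
  define F where "F = {J. ideal J R \<and> I \<subseteq> J \<and> \<one> \<notin> J}"
  have "\<exists>M\<in>F. (\<forall>J\<in>F. M \<subseteq> J \<longrightarrow> J = M)"
  proof (rule subset_Zorn_nonempty)
    show "F \<noteq> {}" using I one unfolding F_def by blast
    fix C assume ne: "C \<noteq> {}" and C: "subset.chain F C"
    have id: "ideal J R" "I \<subseteq> J" "\<one> \<notin> J" if "J \<in> C" for J
      using C that unfolding subset_chain_def F_def by auto
    have lin: "J \<subseteq> J' \<or> J' \<subseteq> J" if "J \<in> C" "J' \<in> C" for J J'
      using C that unfolding subset_chain_def F_def by auto
    obtain J0 where J0: "J0 \<in> C" using ne by blast
    have "ideal (\<Union>C) R"
    proof (rule ideal_by_closure)
      show "\<Union>C \<subseteq> carrier R" by (rule Union_least) (use ideal.Icarr[OF id(1)] in blast)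
      show "\<Union>C \<noteq> {}"
        using additive_subgroup.zero_closed[OF ideal.axioms(1)[OF id(1)[OF J0]]] J0 by blast
      show "a \<oplus> b \<in> \<Union>C" if ab: "a \<in> \<Union>C" "b \<in> \<Union>C" for a b
      proof -
        from ab obtain J J' where J: "a \<in> J" "J \<in> C" "b \<in> J'" "J' \<in> C" by blast
        have closed: "a \<oplus> b \<in> L" if "a \<in> L" "b \<in> L" "L \<in> C" for L
          by (rule additive_subgroup.a_closed[OF ideal.axioms(1)[OF id(1)[OF that(3)]] that(1,2)])
        from lin[OF J(2,4)] show ?thesis
        proof
          assume "J \<subseteq> J'"
          thus ?thesis using closed[of J'] J by blast
        next
          assume "J' \<subseteq> J"
          thus ?thesis using closed[of J] J by blast
        qed
      qed
      show "t \<otimes> a \<in> \<Union>C" if a: "a \<in> \<Union>C" and t: "t \<in> carrier R" for a t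
      proof -
        from a obtain J where "a \<in> J" "J \<in> C" by blast
        thus ?thesis using ideal.I_l_closed[OF id(1) _ t] by blast
      qed
    qed
    thus "\<Union>C \<in> F" using J0 id(2)[OF J0] id(3) unfolding F_def by blast
  qed
  then obtain M where MF: "M \<in> F" and max: "\<forall>J\<in>F. M \<subseteq> J \<longrightarrow> J = M" ..
  hence M: "ideal M R" "I \<subseteq> M" "\<one> \<notin> M" unfolding F_def by auto
  have "maximalideal M R"
  proof (rule maximalidealI[OF M(1)])
    show "carrier R \<noteq> M" using M(3) by blast
    show "J = M \<or> J = carrier R" if J: "ideal J R" "M \<subseteq> J" "J \<subseteq> carrier R" for J
    proof (cases "\<one> \<in> J")
      case True
      thus ?thesis using ideal.one_imp_carrier[OF J(1)] by simp
    next
      case False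
      hence "J \<in> F" using J M(2) unfolding F_def by simp
      thus ?thesis using max J(2) by simp
    qed
  qed
  thus ?thesis using M(2) by blast
qed

text \<open>Locality is stated through units, with the maximal ideal as a parameter. For subrings and quotients
of a local ring the units are visible at once, and uniqueness of the maximal ideal follows.\<close>

locale local_cring = cring R for R (structure) +
  fixes m
  assumes m_ideal: "ideal m R"
    and one_notin_m: "\<one> \<notin> m"
    and unit_outside_m: "\<And>x. x \<in> carrier R \<Longrightarrow> x \<notin> m \<Longrightarrow> \<exists>y\<in>carrier R. x \<otimes> y = \<one>"
begin

lemma m_carr [simp]: "x \<in> m \<Longrightarrow> x \<in> carrier R"
  using ideal.Icarr[OF m_ideal] .

lemma proper_ideal_in_m:
  assumes "ideal I R" "\<one> \<notin> I"
  shows "I \<subseteq> m"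
proof
  fix x assume x: "x \<in> I"
  show "x \<in> m"
  proof (rule ccontr)
    assume "x \<notin> m"
    then obtain y where "y \<in> carrier R" "x \<otimes> y = \<one>"
      using unit_outside_m ideal.Icarr[OF assms(1) x] by blast
    thus False using ideal.I_r_closed[OF assms(1) x] assms(2) by metis
  qed
qed

lemma maximalideal_iff: "maximalideal M R \<longleftrightarrow> M = m"
proof
  assume "maximalideal M R"
  then interpret maximalideal M R .
  have "\<one> \<notin> M" using I_notcarr one_imp_carrier by blast
  hence "M \<subseteq> m" by (rule proper_ideal_in_m[OF is_ideal])
  moreover have "m \<subseteq> carrier R" by auto
  ultimately have "m = M \<or> m = carrier R" using I_maximal m_ideal by blast
  thus "M = m" using one_notin_m by auto
next
  assume "M = m"
  moreover have "maximalideal m R"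
  proof (rule maximalidealI[OF m_ideal])
    show "carrier R \<noteq> m" using one_notin_m by auto
    show "J = m \<or> J = carrier R" if "ideal J R" "m \<subseteq> J" "J \<subseteq> carrier R" for J
      using proper_ideal_in_m[OF that(1)] ideal.one_imp_carrier[OF that(1)] that(2) by blast
  qed
  ultimately show "maximalideal M R" by simp
qed

lemma is_local_ring: "local_ring R"
  unfolding local_ring_def using maximalideal_iff is_cring by blast

lemma max_ideal_eq: "max_ideal R = m"
  unfolding max_ideal_def using maximalideal_iff by auto

lemma socle_mem_iff: "x \<in> socle R \<longleftrightarrow> x \<in> carrier R \<and> (\<forall>y\<in>m. x \<otimes> y = \<zero>)"
  unfolding socle_def max_ideal_eq by simp

end

lemma local_ring_imp_local_cring:
  fixes R (structure)
  assumes "local_ring R"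
  shows "local_cring R (max_ideal R)"
proof -
  interpret cring R using assms unfolding local_ring_def by blast
  have ex1: "\<exists>!M. maximalideal M R" using assms unfolding local_ring_def by blast
  have max: "maximalideal (max_ideal R) R"
    unfolding max_ideal_def using theI'[OF ex1] .
  then interpret M: maximalideal "max_ideal R" R .
  show ?thesis
  proof unfold_locales
    show "\<one> \<notin> max_ideal R" using M.I_notcarr M.one_imp_carrier by blast
    fix x assume x: "x \<in> carrier R" "x \<notin> max_ideal R"
    have "\<one> \<in> PIdl x"
    proof (rule ccontr)
      assume "\<one> \<notin> PIdl x"
      then obtain N where "maximalideal N R" "PIdl x \<subseteq> N"
        using proper_ideal_in_maximal[OF cgenideal_ideal[OF x(1)]] by blast
      moreover from this have "N = max_ideal R" using ex1 max by blast
      ultimately show False using x cgenideal_self by blast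
    qed
    then obtain y where "y \<in> carrier R" "\<one> = y \<otimes> x" unfolding cgenideal_def by blast
    thus "\<exists>y\<in>carrier R. x \<otimes> y = \<one>" using x(1) m_comm by metis
  qed
qed

lemma (in cring) mem_ideal_extension_iff:
  "x \<in> C <+>\<^bsub>R\<^esub> PIdl b \<longleftrightarrow> (\<exists>c\<in>C. \<exists>t\<in>carrier R. x = c \<oplus> t \<otimes> b)"
  unfolding set_add_def' cgenideal_def by blast

lemma (in cring) ideal_extension:
  assumes "ideal C R" and b: "b \<in> carrier R"
  shows "ideal (C <+>\<^bsub>R\<^esub> PIdl b) R" and "C \<subseteq> C <+>\<^bsub>R\<^esub> PIdl b" and "b \<in> C <+>\<^bsub>R\<^esub> PIdl b"
proof -
  interpret C: ideal C R by fact
  show "ideal (C <+>\<^bsub>R\<^esub> PIdl b) R"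
    by (rule add_ideals[OF assms(1) cgenideal_ideal[OF b]])
  have "c = c \<oplus> \<zero> \<otimes> b" if "c \<in> C" for c using C.Icarr[OF that] b by simp
  thus "C \<subseteq> C <+>\<^bsub>R\<^esub> PIdl b" using zero_closed unfolding mem_ideal_extension_iff subset_iff by blast
  have "b = \<zero> \<oplus> \<one> \<otimes> b" using b by simp
  thus "b \<in> C <+>\<^bsub>R\<^esub> PIdl b" using one_closed C.zero_closed unfolding mem_ideal_extension_iff by blast
qed

definition annihilator :: "('a, 'm) ring_scheme \<Rightarrow> 'a set \<Rightarrow> 'a set" where
  "annihilator R A = {x \<in> carrier R. \<forall>a\<in>A. x \<otimes>\<^bsub>R\<^esub> a = \<zero>\<^bsub>R\<^esub>}"

lemma annihilator_carr: "x \<in> annihilator R A \<Longrightarrow> x \<in> carrier R"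
  by (simp add: annihilator_def)

lemma annihilatorD: "x \<in> annihilator R A \<Longrightarrow> a \<in> A \<Longrightarrow> x \<otimes>\<^bsub>R\<^esub> a = \<zero>\<^bsub>R\<^esub>"
  by (simp add: annihilator_def)

lemma annihilatorI:
  "x \<in> carrier R \<Longrightarrow> (\<And>a. a \<in> A \<Longrightarrow> x \<otimes>\<^bsub>R\<^esub> a = \<zero>\<^bsub>R\<^esub>) \<Longrightarrow> x \<in> annihilator R A"
  by (simp add: annihilator_def)

lemma (in cring) annihilator_ideal:
  assumes "A \<subseteq> carrier R"
  shows "ideal (annihilator R A) R"
proof (rule idealI)
  show "ring R" by (rule ring_axioms)
  show "subgroup (annihilator R A) (add_monoid R)"
    by (rule add.subgroupI) (use assms in \<open>auto simp: annihilator_def subset_iff l_minus l_distr\<close>)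
  show "x \<otimes> a \<in> annihilator R A" "a \<otimes> x \<in> annihilator R A"
    if "a \<in> annihilator R A" "x \<in> carrier R" for a x
  proof -
    show "x \<otimes> a \<in> annihilator R A"
      using that assms unfolding annihilator_def by (auto simp: subset_iff m_assoc)
    thus "a \<otimes> x \<in> annihilator R A"
      using that m_comm[of a x] unfolding annihilator_def by simp
  qed
qed

locale artin_local = local_cring +
  assumes artinian: "artinian_ring R"
begin

lemma descending_chain_stops:
  assumes "\<And>n. ideal (f n) R" "\<And>n. f (Suc n) \<subseteq> f n"
  shows "\<exists>N. \<forall>n\<ge>N. f n = f N"
proof -
  have "\<forall>n. ideal (f n) R \<and> f (Suc n) \<subseteq> f n" by (intro allI conjI assms)
  thus ?thesis using artinian unfolding artinian_ring_def by (elim conjE) (drule spec[of _ f], drule mp)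
qed

text \<open>The descending chain condition in the form that supports induction on ideals and the choice of
minimal ideals.\<close>

lemma wf_ideals: "wf {(I, J). ideal I R \<and> ideal J R \<and> I \<subset> J}"
proof (unfold wf_iff_no_infinite_down_chain, rule notI)
  assume "\<exists>f. \<forall>i. (f (Suc i), f i) \<in> {(I, J). ideal I R \<and> ideal J R \<and> I \<subset> J}"
  then obtain f where "\<forall>i. (f (Suc i), f i) \<in> {(I, J). ideal I R \<and> ideal J R \<and> I \<subset> J}"
    by (rule exE)
  hence f: "ideal (f (Suc i)) R \<and> ideal (f i) R \<and> f (Suc i) \<subset> f i" for i by simp
  have "\<exists>N. \<forall>n\<ge>N. f n = f N" by (rule descending_chain_stops) (use f in auto)
  then obtain N where N: "\<forall>n\<ge>N. f n = f N" by (rule exE)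
  have "f (Suc N) = f N" by (rule N[rule_format]) simp
  with f[of N] show False by simp
qed

lemma ideal_induct [consumes 1, case_names less]:
  assumes "ideal I R"
    and "\<And>I. ideal I R \<Longrightarrow> (\<And>J. ideal J R \<Longrightarrow> J \<subset> I \<Longrightarrow> P J) \<Longrightarrow> P I"
  shows "P I"
  using assms(1)
proof (induction I rule: wf_induct_rule[OF wf_ideals])
  case (1 I)
  show ?case
  proof (rule assms(2)[OF 1(2)])
    show "P J" if "ideal J R" "J \<subset> I" for J using 1(1)[of J] 1(2) that by simp
  qed
qed

lemma minimal_ideal:
  assumes "ideal A R" "P A"
  obtains B where "ideal B R" "P B" "B \<subseteq> A" "\<And>J. ideal J R \<Longrightarrow> J \<subset> B \<Longrightarrow> \<not> P J"
proof -
  have "P A \<longrightarrow> (\<exists>B. ideal B R \<and> P B \<and> B \<subseteq> A \<and> (\<forall>J. ideal J R \<longrightarrow> J \<subset> B \<longrightarrow> \<not> P J))"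
    using assms(1)
  proof (induction A rule: ideal_induct)
    case (less I)
    show ?case
    proof (cases "\<exists>J. ideal J R \<and> J \<subset> I \<and> P J")
      case True
      then obtain J where "ideal J R" "J \<subset> I" "P J" by blast
      thus ?thesis using less.IH[of J] by blast
    next
      case False
      thus ?thesis using less.hyps by blast
    qed
  qed
  thus ?thesis using assms(2) that by blast
qed

text \<open>A nonzero module \<open>A / C\<close> over an Artinian local ring has a nonzero socle. Any \<open>b \<notin> C\<close> in an ideal \<open>B\<close>
minimal among those strictly above \<open>C\<close> will do: otherwise \<open>C + (y b)\<close> is all of \<open>B\<close> for some \<open>y\<close> in the
maximal ideal, so \<open>b = c + t y b\<close>, and the unit \<open>1 - t y\<close> brings \<open>b\<close> back into \<open>C\<close>.\<close>

lemma socle_element_mod: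
  assumes C: "ideal C R" and A: "ideal A R" and "C \<subset> A"
  obtains b where "b \<in> A" "b \<notin> C" "\<And>y. y \<in> m \<Longrightarrow> y \<otimes> b \<in> C"
proof -
  obtain B where B: "ideal B R" "C \<subset> B" "B \<subseteq> A"
    and min: "\<And>J. ideal J R \<Longrightarrow> J \<subset> B \<Longrightarrow> \<not> C \<subset> J"
    using minimal_ideal[of A "\<lambda>J. C \<subset> J", OF A \<open>C \<subset> A\<close>] by (metis (no_types))
  interpret B: ideal B R by fact
  interpret C: ideal C R by fact
  interpret m: ideal m R by (rule m_ideal)
  obtain b where b: "b \<in> B" "b \<notin> C" using B(2) by blast
  have bc: "b \<in> carrier R" using b B.Icarr by blast
  have "y \<otimes> b \<in> C" if y: "y \<in> m" for y
  proof (rule ccontr)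
    assume n: "y \<otimes> b \<notin> C"
    let ?D = "C <+>\<^bsub>R\<^esub> PIdl (y \<otimes> b)"
    have yb: "y \<otimes> b \<in> carrier R" using y bc by simp
    note D = ideal_extension[OF C yb]
    have "C \<subset> ?D" using n D(2,3) by blast
    moreover have "?D \<subseteq> B"
    proof
      fix x assume "x \<in> ?D"
      then obtain c t where c: "c \<in> C" and t: "t \<in> carrier R" and e: "x = c \<oplus> t \<otimes> (y \<otimes> b)"
        unfolding mem_ideal_extension_iff by blast
      have "t \<otimes> (y \<otimes> b) \<in> B"
        using B.I_l_closed[OF B.I_l_closed[OF b(1) m_carr[OF y]] t] .
      thus "x \<in> B" unfolding e using B(2) c B.a_closed by blast
    qed
    ultimately have "?D = B" using min[OF D(1)] by blast
    then obtain c t where c: "c \<in> C" and t: "t \<in> carrier R" and e: "b = c \<oplus> t \<otimes> (y \<otimes> b)"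
      using b(1) mem_ideal_extension_iff[of b C "y \<otimes> b"] by blast
    let ?u = "\<one> \<ominus> t \<otimes> y"
    have ty: "t \<otimes> y \<in> m" using m.I_l_closed[OF y t] .
    have u: "?u \<in> carrier R" using t y by simp
    have "?u \<notin> m"
    proof
      assume "?u \<in> m"
      hence "?u \<oplus> t \<otimes> y \<in> m" using ty by simp
      moreover have "?u \<oplus> t \<otimes> y = \<one>" using t m_carr[OF y] by algebra
      ultimately show False using one_notin_m by simp
    qed
    then obtain v where v: "v \<in> carrier R" "?u \<otimes> v = \<one>" using unit_outside_m[OF u] by blast
    have cc: "c \<in> carrier R" using c C.Icarr by blast
    have yc: "y \<in> carrier R" using y by simp
    have "?u \<otimes> b = b \<ominus> t \<otimes> (y \<otimes> b)" using t yc bc by algebra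
    also have "\<dots> = (c \<oplus> t \<otimes> (y \<otimes> b)) \<ominus> t \<otimes> (y \<otimes> b)" using e by simp
    also have "\<dots> = c" using t yc bc cc by algebra
    finally have "?u \<otimes> b = c" .
    moreover have "b = v \<otimes> (?u \<otimes> b)"
    proof -
      have "v \<otimes> (?u \<otimes> b) = (?u \<otimes> v) \<otimes> b" using v(1) u bc by algebra
      thus ?thesis using v bc by simp
    qed
    ultimately have "b = v \<otimes> c" by simp
    hence "b \<in> C" using C.I_l_closed[OF c v(1)] by simp
    thus False using b(2) by simp
  qed
  thus ?thesis using that b B(3) by blast
qed

end

section \<open>Annihilators in Gorenstein algebras\<close>

text \<open>The subfield \<open>k\<close> is a coefficient field: it maps isomorphically onto the residue field. As it lies
inside \<open>R\<close>, ideals are subspaces of \<open>R\<close> over \<open>k\<close> and have a dimension.\<close>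

locale gorenstein_algebra = artin_local +
  fixes \<delta> k
  assumes delta_carr: "\<delta> \<in> carrier R" and delta_nz: "\<delta> \<noteq> \<zero>"
    and socle_gen: "socle R = PIdl \<delta>"
    and k_subfield: "subfield k R"
    and coeff_exists: "\<And>x. x \<in> carrier R \<Longrightarrow> \<exists>c\<in>k. x \<ominus> c \<in> m"
begin

lemmas k_props = subringE[OF subfieldE(1)[OF k_subfield]]

lemma k_carr [simp]: "c \<in> k \<Longrightarrow> c \<in> carrier R"
  using k_props(1) by blast

lemma k_inter_m: "c \<in> k \<Longrightarrow> c \<in> m \<Longrightarrow> c = \<zero>"
  using subfield_m_inv(1,2)[OF k_subfield, of c] ideal.I_r_closed[OF m_ideal, of c "inv c"] one_notin_m
  by (metis Diff_iff k_carr singletonD singletonI)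

lemma unit_multiple_mem:
  assumes "x \<in> carrier R" "x \<notin> m" "z \<in> carrier R" "ideal I R" "x \<otimes> z \<in> I"
  shows "z \<in> I"
proof -
  obtain y where y: "y \<in> carrier R" "x \<otimes> y = \<one>" using unit_outside_m assms by blast
  have "y \<otimes> (x \<otimes> z) = (x \<otimes> y) \<otimes> z" using assms(1,3) y(1) by algebra
  hence "z = y \<otimes> (x \<otimes> z)" using assms(3) y by simp
  thus ?thesis using ideal.I_l_closed[OF assms(4,5) y(1)] by simp
qed

lemma socle_eq_annihilator: "socle R = annihilator R m"
  unfolding annihilator_def using socle_mem_iff by auto

lemma socle_ideal: "ideal (socle R) R"
  unfolding socle_gen by (rule cgenideal_ideal[OF delta_carr])

lemma delta_socle: "\<delta> \<in> socle R"
  unfolding socle_gen by (rule cgenideal_self[OF delta_carr])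

lemma socle_mult: "s \<in> socle R \<Longrightarrow> y \<in> m \<Longrightarrow> s \<otimes> y = \<zero>" "s \<in> socle R \<Longrightarrow> y \<in> m \<Longrightarrow> y \<otimes> s = \<zero>"
  using socle_mem_iff[of s] m_comm[of s y] by auto

text \<open>The socle is a line over \<open>k\<close>, since \<open>m\<close> acts on \<open>\<delta>\<close> by zero.\<close>

lemma socle_line: "s \<in> socle R \<longleftrightarrow> (\<exists>c\<in>k. s = c \<otimes> \<delta>)"
proof
  assume "s \<in> socle R"
  then obtain t where t: "t \<in> carrier R" "s = t \<otimes> \<delta>" unfolding socle_gen cgenideal_def by blast
  obtain c where c: "c \<in> k" "t \<ominus> c \<in> m" using coeff_exists[OF t(1)] by blast
  have "(t \<ominus> c) \<otimes> \<delta> = \<zero>" using socle_mult(2)[OF delta_socle c(2)] .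
  moreover have "t \<otimes> \<delta> = c \<otimes> \<delta> \<oplus> (t \<ominus> c) \<otimes> \<delta>" using t(1) k_carr[OF c(1)] delta_carr by algebra
  ultimately have "s = c \<otimes> \<delta>" using t c delta_carr by simp
  thus "\<exists>c\<in>k. s = c \<otimes> \<delta>" using c(1) by blast
next
  assume "\<exists>c\<in>k. s = c \<otimes> \<delta>"
  thus "s \<in> socle R" using ideal.I_l_closed[OF socle_ideal delta_socle] k_carr by blast
qed

lemma ideal_inter_annihilator:
  assumes "ideal I R" "b \<in> carrier R"
  shows "ideal (I \<inter> annihilator R {b}) R"
  using i_intersect[OF assms(1) annihilator_ideal] assms(2) by simp

text \<open>The assumption on products says that multiplication by \<open>b\<close> maps \<open>I\<close> into the socle, which is a
line. Hence its kernel on \<open>I\<close> has codimension one once \<open>b\<close> does not kill \<open>I\<close>, with complement spanned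
by any \<open>w\<close> that it does not kill.\<close>

lemma line_extension_of_annihilator:
  assumes I: "ideal I R" and b: "b \<in> carrier R"
    and kill: "\<And>z y. z \<in> I \<Longrightarrow> y \<in> m \<Longrightarrow> z \<otimes> (y \<otimes> b) = \<zero>"
    and w: "w \<in> I" "w \<otimes> b \<noteq> \<zero>"
  shows "I = line_extension k w (I \<inter> annihilator R {b})"
proof -
  interpret I: ideal I R by fact
  have soc: "z \<otimes> b \<in> socle R" if z: "z \<in> I" for z
    unfolding socle_mem_iff
  proof (intro conjI ballI)
    show "z \<otimes> b \<in> carrier R" using I.Icarr[OF z] b by simp
    fix y assume y: "y \<in> m"
    have "z \<otimes> b \<otimes> y = z \<otimes> (y \<otimes> b)" using I.Icarr[OF z] b m_carr[OF y] by algebra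
    thus "z \<otimes> b \<otimes> y = \<zero>" using kill[OF z y] by simp
  qed
  obtain c where c: "c \<in> k" "w \<otimes> b = c \<otimes> \<delta>" using soc[OF w(1)] unfolding socle_line by blast
  have "c \<noteq> \<zero>" using w(2) c delta_carr by auto
  hence ci: "inv c \<in> k" "inv c \<otimes> c = \<one>" using subfield_m_inv[OF k_subfield, of c] c(1) by auto
  show ?thesis
  proof (intro equalityI subsetI)
    fix z assume z: "z \<in> I"
    obtain d where d: "d \<in> k" "z \<otimes> b = d \<otimes> \<delta>" using soc[OF z] unfolding socle_line by blast
    let ?e = "d \<otimes> inv c"
    have e: "?e \<in> k" using d(1) ci(1) k_props(6) by blast
    have "z \<ominus> ?e \<otimes> w \<in> I"
      using I.I_l_closed[OF w(1) k_carr[OF e]] z by (simp add: a_minus_def)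
    moreover have "(z \<ominus> ?e \<otimes> w) \<otimes> b = \<zero>"
    proof -
      have "(z \<ominus> ?e \<otimes> w) \<otimes> b = z \<otimes> b \<ominus> ?e \<otimes> (w \<otimes> b)"
        using I.Icarr[OF z] I.Icarr[OF w(1)] b k_carr[OF e] by algebra
      also have "\<dots> = d \<otimes> \<delta> \<ominus> d \<otimes> (inv c \<otimes> c) \<otimes> \<delta>"
        unfolding d c using k_carr[OF c(1)] k_carr[OF ci(1)] k_carr[OF d(1)] delta_carr by algebra
      also have "\<dots> = \<zero>" unfolding ci(2) using k_carr[OF d(1)] delta_carr by algebra
      finally show ?thesis .
    qed
    moreover have "z = ?e \<otimes> w \<oplus> (z \<ominus> ?e \<otimes> w)"
      using I.Icarr[OF z] I.Icarr[OF w(1)] k_carr[OF e] by algebra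
    ultimately show "z \<in> line_extension k w (I \<inter> annihilator R {b})"
      unfolding line_extension_mem_iff annihilator_def using e I.Icarr by blast
  next
    fix z assume "z \<in> line_extension k w (I \<inter> annihilator R {b})"
    then obtain e v where "e \<in> k" "v \<in> I" "z = e \<otimes> w \<oplus> v" unfolding line_extension_mem_iff by blast
    thus "z \<in> I" using I.I_l_closed[OF w(1)] by simp
  qed
qed

text \<open>Artinian induction: for \<open>I \<noteq> 0\<close> choose \<open>b\<close> outside the annihilator of \<open>I\<close> such that \<open>m b\<close> kills \<open>I\<close>.
The part of \<open>I\<close> killed by \<open>b\<close> is a smaller ideal, and of codimension one.\<close>

lemma finite_dimensional_ideal:
  assumes "ideal I R"
  shows "\<exists>n. dimension n k I"
  using assms
proof (induction I rule: ideal_induct)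
  case (less I)
  interpret I: ideal I R by (rule less.hyps)
  show ?case
  proof (cases "I = {\<zero>}")
    case True
    thus ?thesis using zero_dim by blast
  next
    case False
    then obtain w0 where w0: "w0 \<in> I" "w0 \<noteq> \<zero>" using I.zero_closed by blast
    have ann: "ideal (annihilator R I) R" by (rule annihilator_ideal[OF I.a_subset])
    have "\<one> \<notin> annihilator R I" using w0 I.Icarr[OF w0(1)] unfolding annihilator_def by auto
    hence "annihilator R I \<subset> carrier R" unfolding annihilator_def by blast
    then obtain b where b: "b \<in> carrier R" "b \<notin> annihilator R I"
      and mb: "\<And>y. y \<in> m \<Longrightarrow> y \<otimes> b \<in> annihilator R I"
      by (rule socle_element_mod[OF ann oneideal]) auto
    obtain w where w: "w \<in> I" "b \<otimes> w \<noteq> \<zero>" using b unfolding annihilator_def by blast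
    hence wb: "w \<otimes> b \<noteq> \<zero>" using m_comm b(1) I.Icarr by metis
    have kill: "z \<otimes> (y \<otimes> b) = \<zero>" if "z \<in> I" "y \<in> m" for z y
      using mb[OF that(2)] that I.Icarr[OF that(1)] m_comm unfolding annihilator_def by auto
    let ?J = "I \<inter> annihilator R {b}"
    have wJ: "w \<notin> ?J" using wb unfolding annihilator_def by blast
    hence "?J \<subset> I" using w(1) by blast
    then obtain n where "dimension n k ?J"
      using less.IH[OF ideal_inter_annihilator[OF less.hyps b(1)]] by blast
    hence "dimension (Suc n) k (line_extension k w ?J)"
      by (rule Suc_dim[OF I.Icarr[OF w(1)] wJ])
    moreover have "I = line_extension k w ?J"
      by (rule line_extension_of_annihilator[OF less.hyps b(1) kill w(1) wb])
    ultimately have "dimension (Suc n) k I" by metis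
    thus ?thesis by blast
  qed
qed

definition dimk where "dimk E = (dim over k) E"

lemma dimk_dimension: "ideal I R \<Longrightarrow> dimension (dimk I) k I"
  unfolding dimk_def using finite_dimensionE[OF k_subfield] finite_dimensional_ideal
  unfolding finite_dimension_def by blast

lemma dimk_eqI: "dimension n k I \<Longrightarrow> dimk I = n"
  unfolding dimk_def using dimI[OF k_subfield] .

lemma dimk_mono:
  assumes "ideal I R" "ideal J R" "I \<subseteq> J"
  shows "dimk I \<le> dimk J" and "dimk I = dimk J \<Longrightarrow> I = J"
proof -
  from exists_base[OF k_subfield dimk_dimension[OF assms(1)]]
  obtain Vs where Vs: "set Vs \<subseteq> carrier R" "independent k Vs" "length Vs = dimk I" "Span k Vs = I"
    by (elim exE conjE)
  have "set Vs \<subseteq> Span k Vs" by (rule Span_base_incl[OF k_subfield Vs(1)])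
  hence sub: "set Vs \<subseteq> J" using Vs(4) assms(3) by (metis subset_trans)
  show "dimk I \<le> dimk J"
    using independent_length_le_dimension[OF k_subfield dimk_dimension[OF assms(2)] Vs(2) sub] Vs(3) by simp
  show "I = J" if "dimk I = dimk J"
    using independent_length_eq_dimension[OF k_subfield dimk_dimension[OF assms(2)] Vs(2) sub] Vs(3,4) that
    by simp
qed

lemma ann_ideal: "ideal A R \<Longrightarrow> ideal (annihilator R A) R"
  by (rule annihilator_ideal[OF additive_subgroup.a_subset[OF ideal.axioms(1)]])

text \<open>Pass from \<open>C\<close> to \<open>A\<close> by adjoining one new element \<open>b\<close> with \<open>m b \<subseteq> C\<close> at a time. The dimension of the
ideal grows by one, that of its annihilator drops by at most one.\<close>

lemma annihilator_dim_mono: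
  assumes C: "ideal C R" and A: "ideal A R" and CA: "C \<subseteq> A"
  shows "dimk (annihilator R C) + dimk C \<le> dimk (annihilator R A) + dimk A"
  using C CA
proof (induction "dimk A - dimk C" arbitrary: C rule: less_induct)
  case less
  note C = less.prems(1)
  interpret A: ideal A R by (rule A)
  interpret C: ideal C R by (rule C)
  show ?case
  proof (cases "C = A")
    case False
    with less.prems have "C \<subset> A" by blast
    then obtain b where b: "b \<in> A" "b \<notin> C" and mb: "\<And>y. y \<in> m \<Longrightarrow> y \<otimes> b \<in> C"
      by (rule socle_element_mod[OF C A]) auto
    have bc: "b \<in> carrier R" using b(1) A.Icarr by blast
    let ?C = "C <+>\<^bsub>R\<^esub> PIdl b"
    note ext = ideal_extension[OF C bc]
    have line: "?C = line_extension k b C"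
    proof (intro equalityI subsetI)
      fix x assume "x \<in> ?C"
      then obtain c t where x: "c \<in> C" "t \<in> carrier R" "x = c \<oplus> t \<otimes> b"
        unfolding mem_ideal_extension_iff by blast
      obtain d where d: "d \<in> k" "t \<ominus> d \<in> m" using coeff_exists[OF x(2)] by blast
      have "x = d \<otimes> b \<oplus> ((t \<ominus> d) \<otimes> b \<oplus> c)"
        unfolding x(3) using x(2) C.Icarr[OF x(1)] bc k_carr[OF d(1)] by algebra
      moreover have "(t \<ominus> d) \<otimes> b \<oplus> c \<in> C" using mb[OF d(2)] x(1) by simp
      ultimately show "x \<in> line_extension k b C" unfolding line_extension_mem_iff using d(1) by blast
    next
      fix x assume "x \<in> line_extension k b C"
      then obtain d v where "d \<in> k" "v \<in> C" "x = d \<otimes> b \<oplus> v" unfolding line_extension_mem_iff by blast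
      hence "x = v \<oplus> d \<otimes> b" using bc k_carr C.Icarr by (simp add: a_comm)
      thus "x \<in> ?C" unfolding mem_ideal_extension_iff using \<open>d \<in> k\<close> \<open>v \<in> C\<close> k_carr by blast
    qed
    have dimC: "dimk ?C = Suc (dimk C)"
      unfolding line by (rule dimk_eqI[OF Suc_dim[OF bc b(2) dimk_dimension[OF C]]])
    have CA': "?C \<subseteq> A"
    proof
      fix x assume "x \<in> ?C"
      then obtain c t where x: "c \<in> C" "t \<in> carrier R" "x = c \<oplus> t \<otimes> b"
        unfolding mem_ideal_extension_iff by blast
      thus "x \<in> A" using A.I_l_closed[OF b(1) x(2)] less.prems(2) by blast
    qed
    have annC: "annihilator R ?C = annihilator R C \<inter> annihilator R {b}"
    proof (intro equalityI subsetI)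
      fix x assume "x \<in> annihilator R ?C"
      thus "x \<in> annihilator R C \<inter> annihilator R {b}" using ext(2,3) unfolding annihilator_def by blast
    next
      fix x assume x: "x \<in> annihilator R C \<inter> annihilator R {b}"
      hence xc: "x \<in> carrier R" unfolding annihilator_def by blast
      have "x \<otimes> y = \<zero>" if yC: "y \<in> ?C" for y
      proof -
        obtain c t where y: "c \<in> C" "t \<in> carrier R" "y = c \<oplus> t \<otimes> b"
          using yC unfolding mem_ideal_extension_iff by blast
        have "x \<otimes> y = x \<otimes> c \<oplus> t \<otimes> (x \<otimes> b)" unfolding y(3) using xc C.Icarr[OF y(1)] y(2) bc by algebra
        thus ?thesis using x y unfolding annihilator_def by simp
      qed
      thus "x \<in> annihilator R ?C" using xc unfolding annihilator_def by simp
    qed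
    have "dimk (annihilator R C) \<le> Suc (dimk (annihilator R ?C))"
    proof (cases "\<exists>w\<in>annihilator R C. w \<otimes> b \<noteq> \<zero>")
      case True
      then obtain w where w: "w \<in> annihilator R C" "w \<otimes> b \<noteq> \<zero>" by blast
      have l: "annihilator R C = line_extension k w (annihilator R C \<inter> annihilator R {b})"
      proof (rule line_extension_of_annihilator[OF ann_ideal[OF C] bc _ w])
        show "z \<otimes> (y \<otimes> b) = \<zero>" if "z \<in> annihilator R C" "y \<in> m" for z y
          using mb[OF that(2)] that(1) by (simp add: annihilator_def)
      qed
      have eq: "line_extension k w (annihilator R ?C) = annihilator R C"
        unfolding annC by (rule l[symmetric])
      have "w \<notin> annihilator R ?C" unfolding annC using w(2) by (simp add: annihilator_def)
      moreover have "w \<in> carrier R" using w(1) by (simp add: annihilator_def)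
      ultimately have "dimension (Suc (dimk (annihilator R ?C))) k (line_extension k w (annihilator R ?C))"
        by (intro Suc_dim dimk_dimension ann_ideal ext(1))
      hence "dimension (Suc (dimk (annihilator R ?C))) k (annihilator R C)"
        by (simp only: eq)
      thus ?thesis using dimk_eqI by simp
    next
      case False
      hence "annihilator R ?C = annihilator R C" unfolding annC by (auto simp: annihilator_def)
      thus ?thesis by simp
    qed
    moreover have "dimk (annihilator R ?C) + dimk ?C \<le> dimk (annihilator R A) + dimk A"
      using less.hyps[OF _ ext(1) CA'] dimC dimk_mono(1)[OF ext(1) A CA'] by simp
    ultimately show ?thesis using dimC by simp
  qed simp
qed

text \<open>The sum of dimensions is that of \<open>R\<close> both for the zero ideal and for \<open>R\<close>, and by monotonicity it lies
between these two values for \<open>A\<close>.\<close>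

lemma annihilator_dim:
  assumes A: "ideal A R"
  shows "dimk (annihilator R A) + dimk A = dimk (carrier R)"
proof (rule antisym)
  interpret A: ideal A R by fact
  have z: "dimk {\<zero>} = 0" by (rule dimk_eqI) simp
  have "annihilator R (carrier R) = {\<zero>}"
  proof (intro equalityI subsetI)
    fix x assume x: "x \<in> annihilator R (carrier R)"
    have "x \<otimes> \<one> = \<zero>" by (rule annihilatorD[OF x one_closed])
    thus "x \<in> {\<zero>}" using annihilator_carr[OF x] by simp
  qed (simp add: annihilator_def)
  thus "dimk (annihilator R A) + dimk A \<le> dimk (carrier R)"
    using annihilator_dim_mono[OF A oneideal] A.a_subset z by simp
  have "annihilator R {\<zero>} = carrier R" unfolding annihilator_def by auto
  thus "dimk (carrier R) \<le> dimk (annihilator R A) + dimk A"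
    using annihilator_dim_mono[OF zeroideal A] A.zero_closed z by simp
qed

text \<open>Gorenstein duality. One inclusion is formal, and both sides have the same dimension.\<close>

lemma double_annihilator:
  assumes A: "ideal A R"
  shows "annihilator R (annihilator R A) = A"
proof -
  have "A \<subseteq> annihilator R (annihilator R A)"
  proof
    fix a assume a: "a \<in> A"
    show "a \<in> annihilator R (annihilator R A)"
    proof (rule annihilatorI[OF ideal.Icarr[OF A a]])
      fix z assume z: "z \<in> annihilator R A"
      show "a \<otimes> z = \<zero>"
        by (rule trans[OF m_comm[OF ideal.Icarr[OF A a] annihilator_carr[OF z]] annihilatorD[OF z a]])
    qed
  qed
  moreover have "dimk A = dimk (annihilator R (annihilator R A))"
    using annihilator_dim[OF A] annihilator_dim[OF ann_ideal[OF A]] by linarith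
  ultimately show ?thesis using dimk_mono(2)[OF A ann_ideal[OF ann_ideal[OF A]]] by blast
qed

end

section \<open>Ideals complementary to their annihilators\<close>

context gorenstein_algebra begin

lemma socle_subset_m:
  assumes "x \<in> m" "y \<in> m" "x \<otimes> y \<noteq> \<zero>"
  shows "socle R \<subseteq> m"
proof (rule proper_ideal_in_m[OF socle_ideal])
  show "\<one> \<notin> socle R"
    using socle_mult(1)[of \<one> x] assms by auto
qed

lemma annihilator_socle: "annihilator R (socle R) = m"
  unfolding socle_eq_annihilator by (rule double_annihilator[OF m_ideal])

text \<open>The annihilator of \<open>A + ann A\<close> is \<open>ann A \<inter> A\<close>, the socle, and the annihilator of the socle is \<open>m\<close>. By
duality \<open>A + ann A\<close> is all of \<open>m\<close>.\<close>

lemma ideal_add_annihilator: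
  assumes A: "ideal A R" and inter: "A \<inter> annihilator R A = socle R" and x: "x \<in> m"
  shows "\<exists>a\<in>A. \<exists>b\<in>annihilator R A. x = a \<oplus> b"
proof -
  interpret A: ideal A R by fact
  interpret B: ideal "annihilator R A" R by (rule ann_ideal[OF A])
  let ?S = "A <+>\<^bsub>R\<^esub> annihilator R A"
  have S: "ideal ?S R" by (rule add_ideals[OF A B.is_ideal])
  have sub: "z \<in> socle R" if z: "z \<in> annihilator R ?S" for z
  proof -
    have zc: "z \<in> carrier R" by (rule annihilator_carr[OF z])
    have "z \<in> annihilator R A"
    proof (rule annihilatorI[OF zc])
      fix a assume a: "a \<in> A"
      have "a \<oplus> \<zero> \<in> ?S" unfolding set_add_def' using a B.zero_closed by blast
      hence "a \<in> ?S" using A.Icarr[OF a] by simp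
      thus "z \<otimes> a = \<zero>" by (rule annihilatorD[OF z])
    qed
    moreover have "z \<in> annihilator R (annihilator R A)"
    proof (rule annihilatorI[OF zc])
      fix a assume a: "a \<in> annihilator R A"
      have "\<zero> \<oplus> a \<in> ?S" unfolding set_add_def' using a A.zero_closed by blast
      hence "a \<in> ?S" using B.Icarr[OF a] by simp
      thus "z \<otimes> a = \<zero>" by (rule annihilatorD[OF z])
    qed
    ultimately show ?thesis using double_annihilator[OF A] inter by blast
  qed
  have "x \<in> annihilator R (annihilator R ?S)"
  proof (rule annihilatorI[OF m_carr[OF x]])
    fix z assume "z \<in> annihilator R ?S"
    thus "x \<otimes> z = \<zero>" by (rule socle_mult(2)[OF sub x])
  qed
  hence "x \<in> ?S" unfolding double_annihilator[OF S] .
  thus ?thesis unfolding set_add_def' by blast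
qed

text \<open>The annihilator of \<open>m\<^sup>2\<close>. It multiplies \<open>m\<close> into the socle; when it lies in \<open>m\<close>,
multiplication is thus a bilinear form on it with values in a line.\<close>

definition ann_sq where "ann_sq = {x \<in> carrier R. \<forall>y\<in>m. \<forall>z\<in>m. x \<otimes> (y \<otimes> z) = \<zero>}"

lemma ann_sq_eq: "ann_sq = annihilator R {y \<otimes> z | y z. y \<in> m \<and> z \<in> m}"
  unfolding ann_sq_def annihilator_def by blast

lemma ann_sq_ideal: "ideal ann_sq R"
  unfolding ann_sq_eq by (rule annihilator_ideal) auto

lemma ann_sq_mult_m:
  assumes x: "x \<in> ann_sq" and y: "y \<in> m"
  shows "x \<otimes> y \<in> socle R"
proof -
  have xc: "x \<in> carrier R" using x unfolding ann_sq_def by simp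
  show ?thesis unfolding socle_mem_iff
  proof (intro conjI ballI)
    show "x \<otimes> y \<in> carrier R" using xc y by simp
    fix z assume z: "z \<in> m"
    show "x \<otimes> y \<otimes> z = \<zero>"
      using x y z m_assoc[OF xc m_carr[OF y] m_carr[OF z]] unfolding ann_sq_def by simp
  qed
qed

lemma socle_subset_ann_sq: "socle R \<subseteq> ann_sq"
proof
  fix s assume s: "s \<in> socle R"
  hence sc: "s \<in> carrier R" unfolding socle_mem_iff by simp
  have "s \<otimes> (y \<otimes> z) = \<zero>" if "y \<in> m" "z \<in> m" for y z
    using socle_mult(1)[OF s] ideal.I_r_closed[OF m_ideal that(1) m_carr[OF that(2)]] by simp
  thus "s \<in> ann_sq" unfolding ann_sq_def using sc by simp
qed

end

text \<open>That \<open>m\<^sup>3\<close> is not zero expresses, for elements, that the Loewy length is at least three.\<close>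

locale long_gorenstein_algebra = gorenstein_algebra +
  assumes cube_nonzero: "\<exists>x\<in>m. \<exists>y\<in>m. \<exists>z\<in>m. x \<otimes> (y \<otimes> z) \<noteq> \<zero>"
begin

lemma socle_in_m: "socle R \<subseteq> m"
proof -
  obtain x y z where "x \<in> m" "y \<in> m" "z \<in> m" "x \<otimes> (y \<otimes> z) \<noteq> \<zero>" using cube_nonzero by blast
  thus ?thesis using socle_subset_m[of x "y \<otimes> z"] ideal.I_r_closed[OF m_ideal] by simp
qed

lemma ann_sq_in_m: "ann_sq \<subseteq> m"
proof (rule proper_ideal_in_m[OF ann_sq_ideal])
  obtain x y z where "x \<in> m" "y \<in> m" "z \<in> m" "x \<otimes> (y \<otimes> z) \<noteq> \<zero>" using cube_nonzero by blast
  hence "y \<otimes> z \<noteq> \<zero>" "y \<in> m" "z \<in> m" using m_carr by auto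
  thus "\<one> \<notin> ann_sq" unfolding ann_sq_def using m_carr by fastforce
qed

text \<open>The form on \<open>ann_sq\<close> given by multiplication is nonzero. If \<open>u = x\<close> or \<open>u = y\<close> has \<open>u\<^sup>2 \<noteq> 0\<close>,
the line spanned by \<open>u\<close> is nondegenerate; otherwise \<open>x\<close> and \<open>y\<close> with \<open>x y \<noteq> 0\<close> span a hyperbolic plane. The ideal \<open>A\<close> is the
socle together with this line or plane. Its annihilator contains \<open>m\<^sup>2\<close>, hence exceeds the socle because
\<open>m\<^sup>3 \<noteq> 0\<close>.\<close>

lemma splitting_in_ann_sq:
  assumes "x \<in> ann_sq" and "x \<notin> annihilator R ann_sq"
  obtains A where "ideal A R" "A \<inter> annihilator R A = socle R" "A \<noteq> socle R" "annihilator R A \<noteq> socle R"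
proof -
  have D: "ideal ann_sq R" by (rule ann_sq_ideal)
  interpret D: ideal ann_sq R by (rule D)
  interpret soc: ideal "socle R" R by (rule socle_ideal)
  have Dm: "\<And>u. u \<in> ann_sq \<Longrightarrow> u \<in> m" using ann_sq_in_m by blast
  have Ds: "\<And>t u. t \<in> m \<Longrightarrow> u \<in> ann_sq \<Longrightarrow> t \<otimes> u \<in> socle R"
    using ann_sq_mult_m m_comm m_carr D.Icarr by metis
  have xc: "x \<in> carrier R" by (rule D.Icarr[OF assms(1)])
  obtain y where y: "y \<in> ann_sq" "x \<otimes> y \<noteq> \<zero>"
    using assms(2) annihilatorI[OF xc, of ann_sq] by blast
  have yc: "y \<in> carrier R" by (rule D.Icarr[OF y(1)])
  have scalar_in_m: "t \<in> m" if t: "t \<in> carrier R" and ab: "a \<in> carrier R" "a \<noteq> \<zero>" "t \<otimes> a = \<zero>" for t a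
    using unit_multiple_mem[OF t _ ab(1) zeroideal] ab by blast
  have main: "\<exists>A. ideal A R \<and> socle R \<subseteq> A \<and> A \<subseteq> ann_sq \<and> A \<inter> annihilator R A \<subseteq> socle R \<and> A \<noteq> socle R"
  proof -
    have single: ?thesis if u: "u \<in> ann_sq" and uu: "u \<otimes> u \<noteq> \<zero>" for u
    proof -
      have uc: "u \<in> carrier R" by (rule D.Icarr[OF u])
      let ?A = "socle R <+>\<^bsub>R\<^esub> PIdl u"
      note ext = ideal_extension[OF socle_ideal uc]
      have "e \<in> ann_sq \<and> (e \<in> annihilator R ?A \<longrightarrow> e \<in> socle R)" if "e \<in> ?A" for e
      proof -
        from that obtain s t where e: "s \<in> socle R" "t \<in> carrier R" "e = s \<oplus> t \<otimes> u"
          unfolding mem_ideal_extension_iff by blast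
        have "e \<in> ann_sq"
          unfolding e(3) using socle_subset_ann_sq e(1) D.I_l_closed[OF u e(2)] by blast
        moreover have "e \<in> socle R" if ann: "e \<in> annihilator R ?A"
        proof -
          have "e \<otimes> u = \<zero>" by (rule annihilatorD[OF ann ext(3)])
          moreover have "e \<otimes> u = s \<otimes> u \<oplus> t \<otimes> (u \<otimes> u)"
            unfolding e(3) using soc.Icarr[OF e(1)] e(2) uc by algebra
          ultimately have "t \<otimes> (u \<otimes> u) = \<zero>" using socle_mult(1)[OF e(1) Dm[OF u]] e(2) uc by simp
          hence "t \<in> m" using scalar_in_m[OF e(2) _ uu] uc by simp
          thus ?thesis unfolding e(3) using e(1) Ds[OF _ u] by simp
        qed
        ultimately show ?thesis by blast
      qed
      moreover have "?A \<noteq> socle R"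
        using ext(3) socle_mult(1)[OF _ Dm[OF u], of u] uu by metis
      ultimately show ?thesis using ext(1,2) by blast
    qed
    show ?thesis
    proof (cases "x \<otimes> x \<noteq> \<zero> \<or> y \<otimes> y \<noteq> \<zero>")
      case True
      thus ?thesis using single assms(1) y(1) by blast
    next
      case False
      hence sq: "x \<otimes> x = \<zero>" "y \<otimes> y = \<zero>" by auto
      let ?B = "socle R <+>\<^bsub>R\<^esub> PIdl x"
      let ?A = "?B <+>\<^bsub>R\<^esub> PIdl y"
      note extB = ideal_extension[OF socle_ideal xc]
      note ext = ideal_extension[OF extB(1) yc]
      have xA: "x \<in> ?A" using extB(3) ext(2) by blast
      have "e \<in> ann_sq \<and> (e \<in> annihilator R ?A \<longrightarrow> e \<in> socle R)" if "e \<in> ?A" for e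
      proof -
        from that obtain b t' where e': "b \<in> ?B" "t' \<in> carrier R" "e = b \<oplus> t' \<otimes> y"
          unfolding mem_ideal_extension_iff[of e ?B] by blast
        from e'(1) obtain s t where e: "s \<in> socle R" "t \<in> carrier R" "b = s \<oplus> t \<otimes> x"
          unfolding mem_ideal_extension_iff by blast
        have "e \<in> ann_sq"
          unfolding e e' using socle_subset_ann_sq e(1) D.I_l_closed[OF assms(1) e(2)]
            D.I_l_closed[OF y(1) e'(2)] by blast
        moreover have "e \<in> socle R" if ann: "e \<in> annihilator R ?A"
        proof -
          have "e \<otimes> y = s \<otimes> y \<oplus> t \<otimes> (x \<otimes> y) \<oplus> t' \<otimes> (y \<otimes> y)"
            unfolding e e' using soc.Icarr[OF e(1)] e(2) e'(2) xc yc by algebra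
          hence "t \<otimes> (x \<otimes> y) = \<zero>"
            using annihilatorD[OF ann ext(3)] socle_mult(1)[OF e(1) Dm[OF y(1)]] e(2) e'(2) xc yc sq by simp
          hence t: "t \<in> m" using scalar_in_m[OF e(2) _ y(2)] xc yc by simp
          have "e \<otimes> x = s \<otimes> x \<oplus> t \<otimes> (x \<otimes> x) \<oplus> t' \<otimes> (x \<otimes> y)"
            unfolding e e' using soc.Icarr[OF e(1)] e(2) e'(2) xc yc by algebra
          hence "t' \<otimes> (x \<otimes> y) = \<zero>"
            using annihilatorD[OF ann xA] socle_mult(1)[OF e(1) Dm[OF assms(1)]] e(2) e'(2) xc yc sq by simp
          hence t': "t' \<in> m" using scalar_in_m[OF e'(2) _ y(2)] xc yc by simp
          show ?thesis unfolding e e' using e(1) Ds[OF t assms(1)] Ds[OF t' y(1)] by simp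
        qed
        ultimately show ?thesis by blast
      qed
      moreover have "?A \<noteq> socle R"
        using xA socle_mult(1)[OF _ Dm[OF y(1)], of x] y(2) by metis
      ultimately show ?thesis using ext(1,2) extB(2) by blast
    qed
  qed
  then obtain A where A: "ideal A R" "socle R \<subseteq> A" "A \<subseteq> ann_sq" "A \<inter> annihilator R A \<subseteq> socle R" "A \<noteq> socle R"
    by blast
  have socann: "socle R \<subseteq> annihilator R A"
  proof
    fix s assume s: "s \<in> socle R"
    show "s \<in> annihilator R A"
      by (rule annihilatorI[OF soc.Icarr[OF s]]) (use socle_mult(1)[OF s] Dm A(3) in blast)
  qed
  \<comment> \<open>The product of two elements of \<open>m\<close> with nonzero triple product kills \<open>A\<close>, but is not in the socle.\<close>
  have "annihilator R A \<noteq> socle R"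
  proof
    assume eq: "annihilator R A = socle R"
    obtain p q r where pqr: "p \<in> m" "q \<in> m" "r \<in> m" "p \<otimes> (q \<otimes> r) \<noteq> \<zero>" using cube_nonzero by blast
    have "q \<otimes> r \<in> annihilator R A"
    proof (rule annihilatorI)
      show qr: "q \<otimes> r \<in> carrier R" using pqr by simp
      fix a assume "a \<in> A"
      hence a: "a \<in> ann_sq" using A(3) by blast
      hence "a \<otimes> (q \<otimes> r) = \<zero>" using pqr unfolding ann_sq_def by simp
      thus "q \<otimes> r \<otimes> a = \<zero>" using m_comm[OF qr D.Icarr[OF a]] by simp
    qed
    hence "p \<otimes> (q \<otimes> r) = \<zero>" unfolding eq using socle_mult(2) pqr(1) by blast
    thus False using pqr(4) by simp
  qed
  thus thesis using that[of A] A socann by blast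
qed

text \<open>Let \<open>x\<close> be in \<open>I\<close> and kill \<open>I\<close>. As \<open>x J\<close> is in the socle, \<open>x\<close> kills \<open>m\<^sup>2\<close>, so by the last assumption it
lies in the annihilator of \<open>ann_sq\<close>. Every element that kills \<open>I\<^sup>2 + J\<close> kills \<open>m\<^sup>2\<close>, so duality gives
\<open>x \<in> I\<^sup>2 + J\<close>. The component in \<open>J\<close> is then also in \<open>I\<close>, hence in the socle, and \<open>I\<^sup>2\<close> kills \<open>J\<close> because
\<open>I J\<close> is in the socle. So \<open>x\<close> kills \<open>J\<close> as well as \<open>I\<close>.\<close>

lemma splitting_of_separated_ideals:
  assumes I: "ideal I R" and J: "ideal J R"
    and inter: "I \<inter> J = socle R"
    and sum: "\<And>x. x \<in> m \<Longrightarrow> \<exists>a\<in>I. \<exists>b\<in>J. x = a \<oplus> b"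
    and Im: "I \<subseteq> m" and Jm: "J \<subseteq> m" and Jsoc: "J \<noteq> socle R" and Isoc: "I \<noteq> socle R"
    and D: "ann_sq \<subseteq> annihilator R ann_sq"
  shows "I \<inter> annihilator R I = socle R" "annihilator R I \<noteq> socle R"
proof -
  interpret I: ideal I R by fact
  interpret J: ideal J R by fact
  have IJ: "a \<otimes> b \<in> socle R" if a: "a \<in> I" and b: "b \<in> J" for a b
    using I.I_r_closed[OF a J.Icarr[OF b]] J.I_l_closed[OF b I.Icarr[OF a]] inter by blast
  show "I \<inter> annihilator R I = socle R"
  proof (intro equalityI subsetI)
    fix s assume s: "s \<in> socle R"
    hence sI: "s \<in> I" using inter by blast
    have "s \<in> annihilator R I"
      by (rule annihilatorI[OF I.Icarr[OF sI]]) (use socle_mult(1)[OF s] Im in blast)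
    thus "s \<in> I \<inter> annihilator R I" using sI by blast
  next
    fix x assume "x \<in> I \<inter> annihilator R I"
    hence xI: "x \<in> I" and xann: "x \<in> annihilator R I" by auto
    have xc: "x \<in> carrier R" by (rule I.Icarr[OF xI])
    let ?M = "(I \<cdot> I) <+>\<^bsub>R\<^esub> J"
    have II: "ideal (I \<cdot> I) R" by (rule ideal_prod_is_ideal[OF I I])
    interpret II: ideal "I \<cdot> I" R by (rule II)
    have M: "ideal ?M R" by (rule add_ideals[OF II J])
    have MD: "annihilator R ?M \<subseteq> ann_sq"
    proof
      fix z assume z: "z \<in> annihilator R ?M"
      have zc: "z \<in> carrier R" by (rule annihilator_carr[OF z])
      have "z \<otimes> (y \<otimes> y') = \<zero>" if ym: "y \<in> m" "y' \<in> m" for y y'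
      proof -
        obtain a b where ab: "a \<in> I" "b \<in> J" "y = a \<oplus> b" using sum[OF ym(1)] by blast
        obtain a' b' where ab': "a' \<in> I" "b' \<in> J" "y' = a' \<oplus> b'" using sum[OF ym(2)] by blast
        have "y \<otimes> y' = a \<otimes> a' \<oplus> (a \<otimes> b' \<oplus> b \<otimes> y')"
          unfolding ab(3) ab'(3)
          using I.Icarr[OF ab(1)] J.Icarr[OF ab(2)] I.Icarr[OF ab'(1)] J.Icarr[OF ab'(2)] by algebra
        moreover have "a \<otimes> b' \<oplus> b \<otimes> y' \<in> J"
          using J.I_l_closed[OF ab'(2) I.Icarr[OF ab(1)]] J.I_r_closed[OF ab(2) m_carr[OF ym(2)]] by simp
        moreover have "a \<otimes> a' \<in> I \<cdot> I" by (rule ideal_prod.prod[OF ab(1) ab'(1)])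
        ultimately have "y \<otimes> y' \<in> ?M" unfolding set_add_def' by blast
        thus ?thesis by (rule annihilatorD[OF z])
      qed
      thus "z \<in> ann_sq" unfolding ann_sq_def using zc by simp
    qed
    have "x \<in> ann_sq"
    proof -
      have "x \<otimes> (y \<otimes> y') = \<zero>" if ym: "y \<in> m" "y' \<in> m" for y y'
      proof -
        obtain a b where ab: "a \<in> I" "b \<in> J" "y = a \<oplus> b" using sum[OF ym(1)] by blast
        have "x \<otimes> (y \<otimes> y') = x \<otimes> a \<otimes> y' \<oplus> x \<otimes> b \<otimes> y'"
          unfolding ab(3) using xc I.Icarr[OF ab(1)] J.Icarr[OF ab(2)] m_carr[OF ym(2)] by algebra
        thus ?thesis using annihilatorD[OF xann ab(1)] socle_mult(1)[OF IJ[OF xI ab(2)] ym(2)] ym by simp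
      qed
      thus ?thesis unfolding ann_sq_def using xc by simp
    qed
    hence xD: "x \<in> annihilator R ann_sq" using D by blast
    have "x \<in> annihilator R (annihilator R ?M)"
      by (rule annihilatorI[OF xc]) (use annihilatorD[OF xD] MD in blast)
    hence "x \<in> ?M" unfolding double_annihilator[OF M] .
    then obtain a b where ab: "a \<in> I \<cdot> I" "b \<in> J" "x = a \<oplus> b" unfolding set_add_def' by blast
    have aI: "a \<in> I" using ideal_prod_inter[OF I I] ab(1) by blast
    have aJ: "a \<otimes> j = \<zero>" if j: "j \<in> J" for j
      using ab(1)
    proof (induction a rule: ideal_prod.induct)
      case (prod i i')
      have "i \<otimes> i' \<otimes> j = i \<otimes> (i' \<otimes> j)"
        by (rule m_assoc[OF I.Icarr[OF prod(1)] I.Icarr[OF prod(2)] J.Icarr[OF j]])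
      also have "\<dots> = \<zero>" using socle_mult(2)[OF IJ[OF prod(2) j]] prod(1) Im by blast
      finally show ?case .
    next
      case (sum s1 s2)
      thus ?case using II.Icarr J.Icarr[OF j] by (simp add: l_distr)
    qed
    have "b = x \<ominus> a" unfolding ab(3) using I.Icarr[OF aI] J.Icarr[OF ab(2)] by algebra
    hence "b \<in> I" using xI aI by (simp add: a_minus_def)
    hence bs: "b \<in> socle R" using ab(2) inter by blast
    show "x \<in> socle R" unfolding socle_mem_iff
    proof (intro conjI ballI xc)
      fix y assume "y \<in> m"
      then obtain i j where ij: "i \<in> I" "j \<in> J" "y = i \<oplus> j" using sum by blast
      have ic: "i \<in> carrier R" "j \<in> carrier R" using ij I.Icarr J.Icarr by auto
      have "x \<otimes> y = x \<otimes> i \<oplus> (a \<otimes> j \<oplus> b \<otimes> j)"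
        unfolding ij(3) using xc ic r_distr[OF ic xc] l_distr[OF I.Icarr[OF aI] J.Icarr[OF ab(2)] ic(2)] ab(3) by simp
      moreover have "x \<otimes> i = \<zero>" by (rule annihilatorD[OF xann ij(1)])
      moreover have "b \<otimes> j = \<zero>" using socle_mult(1)[OF bs] ij(2) Jm by blast
      ultimately show "x \<otimes> y = \<zero>" using aJ[OF ij(2)] by simp
    qed
  qed
  show "annihilator R I \<noteq> socle R"
  proof
    assume "annihilator R I = socle R"
    hence "I = m" using double_annihilator[OF I] annihilator_socle by simp
    thus False using inter Jm Jsoc by blast
  qed
qed

end

section \<open>Powers of the maximal ideal and constant terms\<close>

context local_cring begin

abbreviation m_power where "m_power n \<equiv> m [^]\<^bsub>ideals_set R\<^esub> (n::nat)"

lemma m_power_0: "m_power 0 = carrier R"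
  by (simp add: nat_pow_def ideals_set_def)

lemma m_power_Suc: "m_power (Suc n) = m_power n \<cdot> m"
  by (simp add: nat_pow_def ideals_set_def)

lemma m_power_ideal: "ideal (m_power n) R"
  by (induction n) (simp_all only: m_power_0 m_power_Suc oneideal ideal_prod_is_ideal m_ideal)

lemma m_power_decreasing: "m_power (Suc n) \<subseteq> m_power n"
  using ideal_prod_inter[OF m_power_ideal m_ideal] unfolding m_power_Suc by blast

lemma m_power_antimono: "n \<le> n' \<Longrightarrow> m_power n' \<subseteq> m_power n"
  by (rule lift_Suc_antimono_le[of m_power]) (rule m_power_decreasing)

lemma m_power_eq_zero_mono:
  assumes "m_power n = {\<zero>}" "n \<le> n'"
  shows "m_power n' = {\<zero>}"
proof -
  have "\<zero> \<in> m_power n'" by (rule additive_subgroup.zero_closed[OF ideal.axioms(1)[OF m_power_ideal]])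
  thus ?thesis using m_power_antimono[OF assms(2)] assms(1) by blast
qed

lemma loewy_length_eq: "loewy_length R = Max {n. m_power n \<noteq> {\<zero>}}"
  unfolding loewy_length_def max_ideal_eq ..

text \<open>If all triple products vanish, then \<open>m\<^sup>3 = 0\<close>; the set of exponents whose maximum defines the Loewy length
is then contained in \<open>{..2}\<close>, in particular finite, so that the maximum is attained in it.\<close>

lemma loewy_length_ge_3_imp:
  assumes "3 \<le> loewy_length R"
  shows "\<exists>x\<in>m. \<exists>y\<in>m. \<exists>z\<in>m. x \<otimes> (y \<otimes> z) \<noteq> \<zero>"
proof (rule ccontr)
  assume "\<not> ?thesis"
  hence triple: "x \<otimes> (y \<otimes> z) = \<zero>" if "x \<in> m" "y \<in> m" "z \<in> m" for x y z using that by blast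
  have p1: "m_power (Suc 0) \<subseteq> m"
    unfolding m_power_Suc m_power_0 using ideal_prod_inter[OF oneideal m_ideal] by blast
  have p2: "x \<in> carrier R \<and> (\<forall>z\<in>m. x \<otimes> z = \<zero>)" if x: "x \<in> m_power (Suc (Suc 0))" for x
    using x unfolding m_power_Suc[of "Suc 0"]
  proof (induction x rule: ideal_prod.induct)
    case (prod i j)
    hence i: "i \<in> m" and j: "j \<in> m" using p1 by auto
    have "i \<otimes> j \<otimes> z = \<zero>" if z: "z \<in> m" for z
      using m_assoc[OF m_carr[OF i] m_carr[OF j] m_carr[OF z]] triple[OF i j z] by simp
    thus ?case using i j by simp
  next
    case (sum s1 s2)
    thus ?case by (simp add: l_distr)
  qed
  have "x = \<zero>" if x: "x \<in> m_power (Suc (Suc (Suc 0)))" for x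
    using x unfolding m_power_Suc[of "Suc (Suc 0)"]
    by (induction x rule: ideal_prod.induct) (simp_all add: p2)
  moreover have "\<zero> \<in> m_power (Suc (Suc (Suc 0)))"
    by (rule additive_subgroup.zero_closed[OF ideal.axioms(1)[OF m_power_ideal]])
  ultimately have z: "m_power (Suc (Suc (Suc 0))) = {\<zero>}" by blast
  have sub: "{n. m_power n \<noteq> {\<zero>}} \<subseteq> {..2}"
  proof
    fix n assume "n \<in> {n. m_power n \<noteq> {\<zero>}}"
    hence "\<not> Suc (Suc (Suc 0)) \<le> n" using m_power_eq_zero_mono[OF z] by blast
    thus "n \<in> {..2}" by simp
  qed
  have "0 \<in> {n. m_power n \<noteq> {\<zero>}}"
    using one_notin_m additive_subgroup.zero_closed[OF ideal.axioms(1)[OF m_ideal]] one_closed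
    unfolding mem_Collect_eq m_power_0 by (metis singletonD)
  hence "loewy_length R \<in> {n. m_power n \<noteq> {\<zero>}}"
    unfolding loewy_length_eq by (intro Max_in finite_subset[OF sub finite_atMost]) blast
  hence "loewy_length R \<le> 2" using sub by blast
  thus False using assms by simp
qed

end

text \<open>The powers of \<open>m\<close> become constant, say equal to \<open>A\<close>, with \<open>A = A m\<close>. If \<open>A \<noteq> 0\<close>, there is \<open>b\<close> that does
not kill \<open>A\<close> while \<open>m b\<close> does; but \<open>b A = b m A = 0\<close>.\<close>

lemma (in artin_local) m_nilpotent: "\<exists>N. m_power N = {\<zero>}"
proof -
  obtain N where N: "\<forall>n\<ge>N. m_power n = m_power N"
    using descending_chain_stops[of m_power, OF m_power_ideal m_power_decreasing] by (rule exE)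
  let ?A = "m_power N"
  interpret A: ideal ?A R by (rule m_power_ideal)
  have eq: "?A = ?A \<cdot> m" using N[rule_format, of "Suc N"] unfolding m_power_Suc by simp
  have ann: "ideal (annihilator R ?A) R" by (rule annihilator_ideal[OF A.a_subset])
  have "annihilator R ?A = carrier R"
  proof (rule ccontr)
    assume "annihilator R ?A \<noteq> carrier R"
    hence "annihilator R ?A \<subset> carrier R"
      by (rule psubsetI[OF additive_subgroup.a_subset[OF ideal.axioms(1)[OF ann]]])
    then obtain b where b: "b \<in> carrier R" "b \<notin> annihilator R ?A"
      and mb: "\<And>y. y \<in> m \<Longrightarrow> y \<otimes> b \<in> annihilator R ?A"
      by (rule socle_element_mod[OF ann oneideal]) auto
    have "b \<otimes> a = \<zero>" if a: "a \<in> ?A \<cdot> m" for a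
      using a
    proof (induction a rule: ideal_prod.induct)
      case (prod i j)
      have ij: "i \<in> carrier R" "j \<in> carrier R" using prod A.Icarr by auto
      have "b \<otimes> (i \<otimes> j) = (j \<otimes> b) \<otimes> i" using b(1) ij by algebra
      also have "\<dots> = \<zero>" by (rule annihilatorD[OF mb[OF prod(2)] prod(1)])
      finally show ?case .
    next
      case (sum s1 s2)
      have "s1 \<in> carrier R" "s2 \<in> carrier R" using sum(1,2) A.Icarr unfolding eq[symmetric] by auto
      thus ?case using sum b(1) by (simp add: r_distr)
    qed
    hence "b \<in> annihilator R ?A" using annihilatorI[OF b(1)] eq by blast
    thus False using b(2) by simp
  qed
  hence one: "\<one> \<in> annihilator R ?A" by simp
  have "a = \<zero>" if "a \<in> ?A" for a using annihilatorD[OF one that] A.Icarr[OF that] by simp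
  hence "?A = {\<zero>}" using A.zero_closed by blast
  thus ?thesis by blast
qed

text \<open>Nilpotency of \<open>m\<close> makes the set of exponents finite, so its maximum bounds every member.\<close>

lemma (in artin_local) loewy_length_ge_2:
  assumes "x \<in> m" "y \<in> m" "x \<otimes> y \<noteq> \<zero>"
  shows "2 \<le> loewy_length R"
proof -
  obtain N where N: "m_power N = {\<zero>}" using m_nilpotent by blast
  have sub: "{n. m_power n \<noteq> {\<zero>}} \<subseteq> {..N}"
  proof
    fix n assume "n \<in> {n. m_power n \<noteq> {\<zero>}}"
    hence "\<not> N \<le> n" using m_power_eq_zero_mono[OF N] by blast
    thus "n \<in> {..N}" by simp
  qed
  have "\<one> \<otimes> x \<otimes> y \<in> m_power (Suc (Suc 0))"
    unfolding m_power_Suc m_power_0 by (intro ideal_prod.prod assms one_closed)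
  hence "x \<otimes> y \<in> m_power (Suc (Suc 0))" using assms(1) by simp
  hence "m_power (Suc (Suc 0)) \<noteq> {\<zero>}" using assms(3) by blast
  hence "Suc (Suc 0) \<le> Max {n. m_power n \<noteq> {\<zero>}}"
    by (intro Max_ge finite_subset[OF sub finite_atMost] CollectI)
  thus ?thesis unfolding loewy_length_eq by simp
qed

context gorenstein_algebra begin

text \<open>The constant term of \<open>x\<close>: its residue class, read in the coefficient field.\<close>

definition coef where "coef x = (THE c. c \<in> k \<and> x \<ominus> c \<in> m)"

lemma coef_unique:
  assumes "x \<in> carrier R" "c \<in> k" "x \<ominus> c \<in> m" "d \<in> k" "x \<ominus> d \<in> m"
  shows "c = d"
proof -
  interpret m: ideal m R by (rule m_ideal)
  have cd: "c \<in> carrier R" "d \<in> carrier R" using assms by auto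
  have "c \<ominus> d = (x \<ominus> d) \<ominus> (x \<ominus> c)" using assms(1) cd by algebra
  hence "c \<ominus> d \<in> m" using assms(3,5) by (simp add: a_minus_def)
  moreover have "c \<ominus> d \<in> k" unfolding a_minus_def using assms k_props(5,7) by blast
  ultimately have "c \<ominus> d = \<zero>" by (rule k_inter_m[rotated])
  thus ?thesis using cd by simp
qed

lemma coef_props:
  assumes "x \<in> carrier R"
  shows "coef x \<in> k" "x \<ominus> coef x \<in> m"
proof -
  obtain c where c: "c \<in> k \<and> x \<ominus> c \<in> m" using coeff_exists[OF assms] by blast
  have "coef x \<in> k \<and> x \<ominus> coef x \<in> m"
    unfolding coef_def
  proof (rule theI[of _ c])
    fix d assume "d \<in> k \<and> x \<ominus> d \<in> m"
    thus "d = c" using coef_unique[OF assms] c by blast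
  qed (rule c)
  thus "coef x \<in> k" "x \<ominus> coef x \<in> m" by auto
qed

lemma coef_carr [simp]: "x \<in> carrier R \<Longrightarrow> coef x \<in> carrier R"
  using coef_props(1) by simp

lemma coef_eqI: "x \<in> carrier R \<Longrightarrow> c \<in> k \<Longrightarrow> x \<ominus> c \<in> m \<Longrightarrow> coef x = c"
  using coef_unique coef_props by blast

lemma m_zero [simp]: "\<zero> \<in> m"
  by (rule additive_subgroup.zero_closed[OF ideal.axioms(1)[OF m_ideal]])

lemma coef_k: "c \<in> k \<Longrightarrow> coef c = c"
  by (rule coef_eqI) (simp_all add: a_minus_def r_neg)

lemma coef_m: "x \<in> m \<Longrightarrow> coef x = \<zero>"
  by (rule coef_eqI) (simp_all add: k_props(2) a_minus_def)

lemma coef_zero_imp_m: "x \<in> carrier R \<Longrightarrow> coef x = \<zero> \<Longrightarrow> x \<in> m"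
  using coef_props(2)[of x] by (simp add: a_minus_def)

lemma coef_hom: "coef \<in> ring_hom R (R \<lparr> carrier := k \<rparr>)"
proof (rule ring_hom_memI)
  interpret m: ideal m R by (rule m_ideal)
  fix x y assume x: "x \<in> carrier R" and y: "y \<in> carrier R"
  note c = coef_props[OF x] and d = coef_props[OF y]
  have cd: "coef x \<in> carrier R" "coef y \<in> carrier R" using x y by auto
  show "coef x \<in> carrier (R \<lparr> carrier := k \<rparr>)" using c by simp
  have "x \<otimes> y \<ominus> coef x \<otimes> coef y = x \<otimes> (y \<ominus> coef y) \<oplus> coef y \<otimes> (x \<ominus> coef x)"
    using x y cd by algebra
  hence "x \<otimes> y \<ominus> coef x \<otimes> coef y \<in> m"
    using m.I_l_closed[OF d(2) x] m.I_l_closed[OF c(2) cd(2)] by simp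
  thus "coef (x \<otimes> y) = coef x \<otimes>\<^bsub>R\<lparr>carrier := k\<rparr>\<^esub> coef y"
    using coef_eqI[of "x \<otimes> y"] k_props(6)[OF c(1) d(1)] x y by simp
  have "(x \<oplus> y) \<ominus> (coef x \<oplus> coef y) = (x \<ominus> coef x) \<oplus> (y \<ominus> coef y)"
    using x y cd by algebra
  hence "(x \<oplus> y) \<ominus> (coef x \<oplus> coef y) \<in> m" using c(2) d(2) by simp
  thus "coef (x \<oplus> y) = coef x \<oplus>\<^bsub>R\<lparr>carrier := k\<rparr>\<^esub> coef y"
    using coef_eqI[of "x \<oplus> y"] k_props(7)[OF c(1) d(1)] x y by simp
next
  show "coef \<one> = \<one>\<^bsub>R\<lparr>carrier := k\<rparr>\<^esub>" using coef_k[OF k_props(3)] by simp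
qed

lemma coef_add: "x \<in> carrier R \<Longrightarrow> y \<in> carrier R \<Longrightarrow> coef (x \<oplus> y) = coef x \<oplus> coef y"
  using ring_hom_add[OF coef_hom] by simp

lemma coef_mult: "x \<in> carrier R \<Longrightarrow> y \<in> carrier R \<Longrightarrow> coef (x \<otimes> y) = coef x \<otimes> coef y"
  using ring_hom_mult[OF coef_hom] by simp

end

section \<open>The subalgebra of constants and an ideal\<close>

text \<open>The situation inside a connected sum: \<open>I\<close> and \<open>J\<close> are the maximal ideals of the two factors, glued
along the socle.\<close>

locale orthogonal_ideals = gorenstein_algebra +
  fixes I J
  assumes I: "ideal I R" and J: "ideal J R"
    and I_sub: "I \<subseteq> m" and J_sub: "J \<subseteq> m"
    and inter: "I \<inter> J = socle R"
    and sum: "\<And>x. x \<in> m \<Longrightarrow> \<exists>a\<in>I. \<exists>b\<in>J. x = a \<oplus> b"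
    and orth: "\<And>a b. a \<in> I \<Longrightarrow> b \<in> J \<Longrightarrow> a \<otimes> b = \<zero>"
    and I_proper: "I \<noteq> socle R" and J_proper: "J \<noteq> socle R"
begin

sublocale I: ideal I R by (rule I)
sublocale J: ideal J R by (rule J)
sublocale m: ideal m R by (rule m_ideal)

lemma I_m [simp]: "a \<in> I \<Longrightarrow> a \<in> m" using I_sub by blast
lemma J_m [simp]: "a \<in> J \<Longrightarrow> a \<in> m" using J_sub by blast

text \<open>Through this interpretation, what is proved for \<open>I\<close> holds for \<open>J\<close>.\<close>

lemma swap: "orthogonal_ideals R m \<delta> k J I"
proof unfold_locales
  show "J \<inter> I = socle R" using inter by blast
  show "\<exists>a\<in>J. \<exists>b\<in>I. x = a \<oplus> b" if xm: "x \<in> m" for x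
  proof -
    obtain a b where ab: "a \<in> I" "b \<in> J" "x = a \<oplus> b" using sum[OF xm] by blast
    have "x = b \<oplus> a" unfolding ab(3) by (rule a_comm[OF I.Icarr[OF ab(1)] J.Icarr[OF ab(2)]])
    thus ?thesis using ab(1,2) by blast
  qed
  show "a \<otimes> b = \<zero>" if "a \<in> J" "b \<in> I" for a b
    using orth[OF that(2,1)] m_comm[OF J.Icarr[OF that(1)] I.Icarr[OF that(2)]] by simp
qed (rule J_sub I_sub J_proper I_proper)+

text \<open>The subring \<open>k + I\<close>.\<close>

definition kI where "kI = {x \<in> carrier R. x \<ominus> coef x \<in> I}"

abbreviation kI_ring where "kI_ring \<equiv> R\<lparr>carrier := kI\<rparr>"

lemma kI_carr: "x \<in> kI \<Longrightarrow> x \<in> carrier R"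
  unfolding kI_def by simp

lemma kI_iff: "x \<in> kI \<longleftrightarrow> (\<exists>c\<in>k. \<exists>a\<in>I. x = c \<oplus> a)"
proof
  assume "x \<in> kI"
  hence x: "x \<in> carrier R" "x \<ominus> coef x \<in> I" unfolding kI_def by auto
  have "x = coef x \<oplus> (x \<ominus> coef x)" using x(1) coef_carr[OF x(1)] by algebra
  thus "\<exists>c\<in>k. \<exists>a\<in>I. x = c \<oplus> a" using x(2) coef_props(1)[OF x(1)] by blast
next
  assume "\<exists>c\<in>k. \<exists>a\<in>I. x = c \<oplus> a"
  then obtain c a where x: "c \<in> k" "a \<in> I" "x = c \<oplus> a" by blast
  have ca: "c \<in> carrier R" "a \<in> carrier R" using x I.Icarr by auto
  have "x \<ominus> c = a" unfolding x(3) using ca by algebra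
  hence "coef x = c" using coef_eqI[of x c] x ca by simp
  thus "x \<in> kI" unfolding kI_def using \<open>x \<ominus> c = a\<close> x ca by simp
qed

lemma k_sub_kI: "c \<in> k \<Longrightarrow> c \<in> kI" unfolding kI_iff using I.zero_closed k_carr r_zero by metis
lemma I_sub_kI: "a \<in> I \<Longrightarrow> a \<in> kI" unfolding kI_iff using k_props(2) I.Icarr l_zero by metis

lemma kI_m_iff: "x \<in> kI \<Longrightarrow> x \<in> m \<longleftrightarrow> x \<in> I"
proof
  assume "x \<in> kI" "x \<in> m"
  thus "x \<in> I" using coef_m[of x] unfolding kI_def by (simp add: a_minus_def)
qed simp

lemma kI_subring: "subring kI R"
proof (rule subringI)
  show "kI \<subseteq> carrier R" using kI_carr by blast
  show "\<one> \<in> kI" by (rule k_sub_kI[OF k_props(3)])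
  fix x assume "x \<in> kI"
  then obtain c a where x: "c \<in> k" "a \<in> I" "x = c \<oplus> a" unfolding kI_iff by blast
  have ca: "c \<in> carrier R" "a \<in> carrier R" using x I.Icarr by auto
  have "\<ominus> x = \<ominus> c \<oplus> \<ominus> a" unfolding x(3) using ca by algebra
  thus "\<ominus> x \<in> kI" unfolding kI_iff using k_props(5)[OF x(1)] I.a_inv_closed[OF x(2)] by blast
  fix y assume "y \<in> kI"
  then obtain d b where y: "d \<in> k" "b \<in> I" "y = d \<oplus> b" unfolding kI_iff by blast
  have db: "d \<in> carrier R" "b \<in> carrier R" using y I.Icarr by auto
  have "x \<oplus> y = (c \<oplus> d) \<oplus> (a \<oplus> b)" unfolding x(3) y(3) using ca db by algebra
  thus "x \<oplus> y \<in> kI" unfolding kI_iff using k_props(7)[OF x(1) y(1)] I.a_closed[OF x(2) y(2)] by blast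
  have "x \<otimes> y = c \<otimes> d \<oplus> (y \<otimes> a \<oplus> c \<otimes> b)" unfolding x(3) y(3) using ca db by algebra
  moreover have "y \<otimes> a \<oplus> c \<otimes> b \<in> I"
    using I.I_l_closed[OF x(2), of y] I.I_l_closed[OF y(2) ca(1)] y(3) db by simp
  ultimately show "x \<otimes> y \<in> kI" unfolding kI_iff using k_props(6)[OF x(1) y(1)] by blast
qed

lemma kI_ring_cring: "cring kI_ring"
  using subcring_iff[of kI] subcringI'[OF kI_subring] subringE(1)[OF kI_subring] by simp

sublocale kI_ring: cring kI_ring
  rewrites "carrier kI_ring = kI" and "(\<otimes>\<^bsub>kI_ring\<^esub>) = (\<otimes>)" and "(\<oplus>\<^bsub>kI_ring\<^esub>) = (\<oplus>)"
    and "\<one>\<^bsub>kI_ring\<^esub> = \<one>" and "\<zero>\<^bsub>kI_ring\<^esub> = \<zero>"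
  by (rule kI_ring_cring) simp_all

lemma I_ideal_kI_ring: "ideal I kI_ring"
proof (rule kI_ring.ideal_by_closure)
  show "I \<subseteq> kI" by (rule subsetI, rule I_sub_kI)
  show "I \<noteq> {}" using I.zero_closed by blast
  show "a \<oplus> b \<in> I" if "a \<in> I" "b \<in> I" for a b by (rule I.a_closed[OF that])
  show "t \<otimes> a \<in> I" if "a \<in> I" "t \<in> kI" for a t by (rule I.I_l_closed[OF that(1) kI_carr[OF that(2)]])
qed

lemma kI_ring_local: "local_cring kI_ring I"
proof (intro local_cring.intro local_cring_axioms.intro kI_ring_cring I_ideal_kI_ring)
  show "\<one>\<^bsub>kI_ring\<^esub> \<notin> I" using one_notin_m by auto
  fix x assume "x \<in> carrier kI_ring" "x \<notin> I"
  hence x: "x \<in> kI" "x \<notin> m" using kI_m_iff by auto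
  have xc: "x \<in> carrier R" by (rule kI_carr[OF x(1)])
  obtain y where y: "y \<in> carrier R" "x \<otimes> y = \<one>" using unit_outside_m[OF xc x(2)] by blast
  \<comment> \<open>The inverse \<open>y\<close> of \<open>x\<close> in \<open>R\<close> lies in \<open>k + I\<close>: with constant terms \<open>c\<close> of \<open>x\<close> and \<open>d\<close> of \<open>y\<close>, it
      is \<open>d - d y (x - c)\<close>.\<close>
  let ?c = "coef x" and ?d = "coef y"
  have cd: "?c \<in> carrier R" "?d \<in> carrier R" using xc y by auto
  have cd1: "?c \<otimes> ?d = \<one>" using coef_mult[OF xc y(1)] y(2) coef_k[OF k_props(3)] by simp
  have xI: "x \<ominus> ?c \<in> I" using x(1) unfolding kI_def by simp
  have "y = (?c \<otimes> ?d) \<otimes> y" using cd1 y(1) by simp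
  also have "\<dots> = ?d \<otimes> (x \<otimes> y) \<ominus> ?d \<otimes> y \<otimes> (x \<ominus> ?c)" using cd xc y(1) by algebra
  also have "\<dots> = ?d \<oplus> \<ominus> (?d \<otimes> y \<otimes> (x \<ominus> ?c))" unfolding y(2) using cd by (simp add: a_minus_def)
  finally have e: "y = ?d \<oplus> \<ominus> (?d \<otimes> y \<otimes> (x \<ominus> ?c))" .
  have "\<ominus> (?d \<otimes> y \<otimes> (x \<ominus> ?c)) \<in> I"
    by (rule I.a_inv_closed[OF I.I_l_closed[OF xI]]) (use cd y in simp)
  hence "y \<in> kI" unfolding kI_iff using e coef_props(1)[OF y(1)] by blast
  thus "\<exists>y\<in>carrier kI_ring. x \<otimes>\<^bsub>kI_ring\<^esub> y = \<one>\<^bsub>kI_ring\<^esub>" using y(2) by auto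
qed

text \<open>Since \<open>J\<close> kills \<open>I\<close>, an element \<open>c + i + j\<close> of \<open>R\<close> acts on \<open>I\<close> like the element \<open>c + i\<close> of \<open>k + I\<close>.\<close>

lemma kI_ring_ideal_imp_ideal:
  assumes B: "ideal B kI_ring" and BI: "B \<subseteq> I"
  shows "ideal B R"
proof (rule ideal_by_closure)
  interpret B: ideal B kI_ring by (rule B)
  show "B \<subseteq> carrier R" using BI I.a_subset by blast
  show "B \<noteq> {}" using B.zero_closed by blast
  show "a \<oplus> b \<in> B" if "a \<in> B" "b \<in> B" for a b using B.a_closed[OF that] by simp
  show "t \<otimes> a \<in> B" if a: "a \<in> B" and t: "t \<in> carrier R" for a t
  proof -
    have aI: "a \<in> I" using a BI by blast
    obtain i j where ij: "i \<in> I" "j \<in> J" "t \<ominus> coef t = i \<oplus> j" using sum[OF coef_props(2)[OF t]] by blast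
    have c: "i \<in> carrier R" "j \<in> carrier R" "a \<in> carrier R" using ij aI I.Icarr J.Icarr by auto
    have "t = coef t \<oplus> (t \<ominus> coef t)" using t coef_carr[OF t] by algebra
    hence "t \<otimes> a = (coef t \<oplus> (i \<oplus> j)) \<otimes> a" unfolding ij(3) by simp
    also have "\<dots> = (coef t \<oplus> i) \<otimes> a \<oplus> a \<otimes> j" using coef_carr[OF t] c by algebra
    also have "a \<otimes> j = \<zero>" by (rule orth[OF aI ij(2)])
    finally have e: "t \<otimes> a = (coef t \<oplus> i) \<otimes> a" using coef_carr[OF t] c by simp
    have "coef t \<oplus> i \<in> kI" unfolding kI_iff using coef_props(1)[OF t] ij(1) by blast
    thus "t \<otimes> a \<in> B" unfolding e using B.I_l_closed[OF a, of "coef t \<oplus> i"] by simp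
  qed
qed

text \<open>A decreasing chain of ideals of \<open>k + I\<close> either is constantly the whole ring, or from some point on
consists of proper ideals, which are ideals of \<open>R\<close>.\<close>

lemma kI_ring_artinian: "artinian_ring kI_ring"
  unfolding artinian_ring_def
proof (intro conjI kI_ring_cring allI impI)
  interpret L: local_cring kI_ring I by (rule kI_ring_local)
  fix f :: "nat \<Rightarrow> 'a set"
  assume "\<forall>n. ideal (f n) kI_ring \<and> f (Suc n) \<subseteq> f n"
  hence f: "ideal (f n) kI_ring" and dec: "f (Suc n) \<subseteq> f n" for n by simp_all
  have anti: "f n' \<subseteq> f n" if "n \<le> n'" for n n'
    using that dec by (rule lift_Suc_antimono_le[of f, rotated])
  show "\<exists>N. \<forall>n\<ge>N. f n = f N"
  proof (cases "\<exists>n0. \<one> \<notin> f n0")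
    case True
    then obtain n0 where n0: "\<one> \<notin> f n0" by blast
    have id: "ideal (f (n0 + n)) R" for n
    proof (rule kI_ring_ideal_imp_ideal[OF f])
      have "\<one> \<notin> f (n0 + n)" using n0 anti[of n0 "n0 + n"] by auto
      thus "f (n0 + n) \<subseteq> I" using L.proper_ideal_in_m[OF f] by simp
    qed
    obtain N where N: "\<forall>n\<ge>N. f (n0 + n) = f (n0 + N)"
      using descending_chain_stops[of "\<lambda>n. f (n0 + n)", OF id] dec by auto
    have "f n = f (n0 + N)" if "n0 + N \<le> n" for n
      using N[rule_format, of "n - n0"] that by simp
    thus ?thesis by blast
  next
    case False
    hence "f n = kI" for n using ideal.one_imp_carrier[OF f] by simp
    thus ?thesis by simp
  qed
qed

lemma orth_elem_socle:
  assumes x: "x \<in> I" and "\<And>y. y \<in> I \<Longrightarrow> x \<otimes> y = \<zero>"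
  shows "x \<in> socle R"
  unfolding socle_mem_iff
proof (intro conjI ballI)
  show xc: "x \<in> carrier R" using x by simp
  fix y assume "y \<in> m"
  then obtain a b where ab: "a \<in> I" "b \<in> J" "y = a \<oplus> b" using sum by blast
  have "x \<otimes> y = x \<otimes> a \<oplus> x \<otimes> b" unfolding ab(3)
    by (rule r_distr[OF I.Icarr[OF ab(1)] J.Icarr[OF ab(2)] xc])
  thus "x \<otimes> y = \<zero>" using assms(2)[OF ab(1)] orth[OF x ab(2)] by simp
qed

lemma not_socle_in_I:
  obtains x where "x \<in> I" "x \<notin> socle R"
  using I_proper inter by blast

lemma not_socle_in_J:
  obtains x where "x \<in> J" "x \<notin> socle R"
  using J_proper inter by blast

lemma nonzero_product_in_I:
  obtains x y where "x \<in> I" "y \<in> I" "x \<otimes> y \<noteq> \<zero>"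
  using not_socle_in_I orth_elem_socle by metis

text \<open>An element of \<open>k + I\<close> that kills \<open>I\<close> is in \<open>I\<close>, as units do not kill \<open>I\<close>. It also kills \<open>J\<close>, hence \<open>m\<close>.\<close>

lemma kI_ring_socle: "socle kI_ring = socle R"
proof -
  interpret L: local_cring kI_ring I by (rule kI_ring_local)
  show ?thesis
  proof (intro equalityI subsetI)
    fix x assume "x \<in> socle kI_ring"
    hence x: "x \<in> kI" and kill: "\<And>y. y \<in> I \<Longrightarrow> x \<otimes> y = \<zero>" unfolding L.socle_mem_iff by auto
    have "x \<in> I"
    proof (rule ccontr)
      assume "x \<notin> I"
      hence xm: "x \<notin> m" using kI_m_iff[OF x] by simp
      obtain p q where pq: "p \<in> I" "q \<in> I" "p \<otimes> q \<noteq> \<zero>" by (rule nonzero_product_in_I)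
      have "x \<otimes> p \<in> {\<zero>}" using kill[OF pq(1)] by simp
      hence "p \<in> {\<zero>}" by (rule unit_multiple_mem[OF kI_carr[OF x] xm I.Icarr[OF pq(1)] zeroideal])
      thus False using pq I.Icarr by simp
    qed
    thus "x \<in> socle R" using kill by (rule orth_elem_socle)
  next
    fix x assume x: "x \<in> socle R"
    hence "x \<in> I" using inter by blast
    thus "x \<in> socle kI_ring" unfolding L.socle_mem_iff using I_sub_kI socle_mult(1)[OF x] by simp
  qed
qed

lemma delta_I: "\<delta> \<in> I" using delta_socle inter by blast

lemma kI_ring_socle_gen: "socle kI_ring = PIdl\<^bsub>kI_ring\<^esub> \<delta>"
proof -
  have "PIdl\<^bsub>kI_ring\<^esub> \<delta> = {x \<otimes> \<delta> | x. x \<in> kI}" unfolding cgenideal_def by simp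
  also have "\<dots> = socle R"
  proof (intro equalityI subsetI)
    fix s assume "s \<in> {x \<otimes> \<delta> | x. x \<in> kI}"
    thus "s \<in> socle R" using ideal.I_l_closed[OF socle_ideal delta_socle] kI_carr by blast
  next
    fix s assume "s \<in> socle R"
    thus "s \<in> {x \<otimes> \<delta> | x. x \<in> kI}" unfolding socle_line using k_sub_kI by blast
  qed
  finally show ?thesis using kI_ring_socle by simp
qed

lemma kI_ring_gorenstein: "gorenstein_artin_local kI_ring"
  unfolding gorenstein_artin_local_def
proof (intro conjI kI_ring_artinian bexI[of _ \<delta>] kI_ring_socle_gen)
  show "local_ring kI_ring" by (rule local_cring.is_local_ring[OF kI_ring_local])
  show "\<delta> \<noteq> \<zero>\<^bsub>kI_ring\<^esub>" using delta_nz by simp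
  show "\<delta> \<in> carrier kI_ring" using I_sub_kI[OF delta_I] by simp
qed

lemma kI_ring_max_ideal: "max_ideal kI_ring = I"
  by (rule local_cring.max_ideal_eq[OF kI_ring_local])

lemma kI_ring_loewy_length: "2 \<le> loewy_length kI_ring"
proof -
  interpret L: artin_local kI_ring I
    by (intro artin_local.intro kI_ring_local artin_local_axioms.intro kI_ring_artinian)
  obtain x y where "x \<in> I" "y \<in> I" "x \<otimes> y \<noteq> \<zero>" by (rule nonzero_product_in_I)
  thus ?thesis using L.loewy_length_ge_2[of x y] by simp
qed

lemma I_psubset_m: "I \<subset> m"
proof -
  obtain x where "x \<in> J" "x \<notin> socle R" by (rule not_socle_in_J)
  hence "x \<in> m" "x \<notin> I" using inter by auto
  thus ?thesis using I_sub by blast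
qed

text \<open>Consider an isomorphism \<open>f\<close> from \<open>R\<close> onto \<open>k + I\<close>. It maps proper ideals of \<open>R\<close> to proper ideals of
\<open>k + I\<close>, which are ideals of \<open>R\<close> inside \<open>I\<close>. In particular \<open>f ` m\<close> is strictly smaller than \<open>m\<close>, and by
injectivity the iterates \<open>f ` f ` m\<close>, \<dots> decrease strictly for ever.\<close>

lemma kI_ring_not_iso: "\<not> kI_ring \<simeq> R"
proof
  assume "kI_ring \<simeq> R"
  hence "R \<simeq> kI_ring" by (rule ring_iso_sym[OF kI_ring.ring_axioms])
  then obtain f where f: "f \<in> ring_iso R kI_ring" unfolding is_ring_iso_def by blast
  note fE = ring_iso_memE[OF f, simplified]
  have inj: "inj_on f (carrier R)" and img: "f ` carrier R = kI" using fE(5) unfolding bij_betw_def by auto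
  interpret L: local_cring kI_ring I by (rule kI_ring_local)
  have step: "f ` A \<subseteq> I \<and> ideal (f ` A) R" if A: "ideal A R" "A \<subseteq> m" for A
  proof -
    interpret A: ideal A R by (rule A(1))
    have id: "ideal (f ` A) kI_ring"
    proof (rule kI_ring.ideal_by_closure)
      show "f ` A \<subseteq> kI" using img A.a_subset by blast
      show "f ` A \<noteq> {}" using A.zero_closed by blast
      fix a assume "a \<in> f ` A"
      then obtain x where x: "x \<in> A" "a = f x" by blast
      show "a \<oplus> b \<in> f ` A" if "b \<in> f ` A" for b
      proof -
        obtain y where y: "y \<in> A" "b = f y" using \<open>b \<in> f ` A\<close> by blast
        have "a \<oplus> b = f (x \<oplus> y)" using fE(3)[OF A.Icarr[OF x(1)] A.Icarr[OF y(1)]] x y by simp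
        thus ?thesis using A.a_closed[OF x(1) y(1)] by blast
      qed
      show "t \<otimes> a \<in> f ` A" if "t \<in> kI" for t
      proof -
        obtain y where y: "y \<in> carrier R" "t = f y" using \<open>t \<in> kI\<close> img by blast
        have "t \<otimes> a = f (y \<otimes> x)" using fE(2)[OF y(1) A.Icarr[OF x(1)]] x y by simp
        thus ?thesis using A.I_l_closed[OF x(1) y(1)] by blast
      qed
    qed
    have "\<one> \<notin> f ` A"
    proof
      assume "\<one> \<in> f ` A"
      then obtain x where x: "x \<in> A" "f x = \<one>" by auto
      hence "x = \<one>" using fE(4) inj A.Icarr[OF x(1)] one_closed unfolding inj_on_def by simp
      thus False using x(1) A(2) one_notin_m by blast
    qed
    hence "f ` A \<subseteq> I" using L.proper_ideal_in_m[OF id] by simp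
    thus ?thesis using kI_ring_ideal_imp_ideal[OF id] by blast
  qed
  have "A \<subseteq> m \<longrightarrow> \<not> f ` A \<subset> A" if "ideal A R" for A
    using that
  proof (induction A rule: ideal_induct)
    case (less A)
    show ?case
    proof (intro impI notI)
      assume Am: "A \<subseteq> m" and sub: "f ` A \<subset> A"
      have "A \<subseteq> carrier R" using Am m.a_subset by blast
      hence "f ` (f ` A) \<subset> f ` A"
        by (rule image_strict_mono[OF inj_on_subset[OF inj] sub])
      moreover have "f ` A \<subseteq> m" using sub Am by blast
      ultimately show False using less.IH[OF conjunct2[OF step[OF less.hyps Am]] sub] by blast
    qed
  qed
  moreover have "f ` m \<subset> m" 
    by (rule subset_psubset_trans[OF conjunct1[OF step[OF m_ideal order_refl]] I_psubset_m])
  ultimately show False using m_ideal by blast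
qed

lemma kI_ring_residue_map:
  assumes h: "h \<in> ring_iso (R\<lparr>carrier := k\<rparr>) K"
  shows "residue_map K kI_ring (h \<circ> coef)"
  unfolding residue_map_def
proof
  have "coef \<in> ring_hom kI_ring (R\<lparr>carrier := k\<rparr>)"
    using ring_hom_memE[OF coef_hom] kI_carr by (intro ring_hom_memI) auto
  moreover have hom: "h \<in> ring_hom (R\<lparr>carrier := k\<rparr>) K" using h unfolding ring_iso_def by simp
  ultimately show "h \<circ> coef \<in> ring_hom kI_ring K" by (rule ring_hom_trans)
  have "coef ` kI = k"
  proof (intro equalityI subsetI)
    fix c assume "c \<in> coef ` kI"
    thus "c \<in> k" using coef_props(1) kI_carr by blast
  next
    fix c assume c: "c \<in> k"
    show "c \<in> coef ` kI" using imageI[OF k_sub_kI[OF c], of coef] by (simp add: coef_k[OF c])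
  qed
  moreover have "h ` k = carrier K" using ring_iso_memE(5)[OF h] unfolding bij_betw_def by simp
  ultimately have "h ` (coef ` kI) = carrier K" by simp
  thus "(h \<circ> coef) ` carrier kI_ring = carrier K" by (simp add: image_image)
qed

end

section \<open>Connected sums from orthogonal ideals\<close>

lemma fibre_product_simps:
  "carrier (fibre_product A f B g) = {(a, b). a \<in> carrier A \<and> b \<in> carrier B \<and> f a = g b}"
  "(a, b) \<otimes>\<^bsub>fibre_product A f B g\<^esub> (a', b') = (a \<otimes>\<^bsub>A\<^esub> a', b \<otimes>\<^bsub>B\<^esub> b')"
  "(a, b) \<oplus>\<^bsub>fibre_product A f B g\<^esub> (a', b') = (a \<oplus>\<^bsub>A\<^esub> a', b \<oplus>\<^bsub>B\<^esub> b')"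
  "\<one>\<^bsub>fibre_product A f B g\<^esub> = (\<one>\<^bsub>A\<^esub>, \<one>\<^bsub>B\<^esub>)"
  "\<zero>\<^bsub>fibre_product A f B g\<^esub> = (\<zero>\<^bsub>A\<^esub>, \<zero>\<^bsub>B\<^esub>)"
  by (simp_all add: fibre_product_def RDirProd_def DirProd_def monoid.defs)

lemma fibre_product_ring:
  assumes "ring_hom_ring A K f" and "ring_hom_ring B K g"
  shows "ring (fibre_product A f B g)"
proof -
  interpret f: ring_hom_ring A K f by fact
  interpret g: ring_hom_ring B K g by fact
  let ?D = "RDirProd A B" and ?H = "{(a, b). a \<in> carrier A \<and> b \<in> carrier B \<and> f a = g b}"
  interpret D: ring ?D by (rule RDirProd_ring[OF f.R.ring_axioms g.R.ring_axioms])
  have D: "carrier ?D = carrier A \<times> carrier B"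
    "\<And>a b a' b'. (a, b) \<otimes>\<^bsub>?D\<^esub> (a', b') = (a \<otimes>\<^bsub>A\<^esub> a', b \<otimes>\<^bsub>B\<^esub> b')"
    "\<And>a b a' b'. (a, b) \<oplus>\<^bsub>?D\<^esub> (a', b') = (a \<oplus>\<^bsub>A\<^esub> a', b \<oplus>\<^bsub>B\<^esub> b')"
    "\<one>\<^bsub>?D\<^esub> = (\<one>\<^bsub>A\<^esub>, \<one>\<^bsub>B\<^esub>)" "\<zero>\<^bsub>?D\<^esub> = (\<zero>\<^bsub>A\<^esub>, \<zero>\<^bsub>B\<^esub>)"
    by (simp_all add: RDirProd_def DirProd_def monoid.defs)
  have neg: "\<ominus>\<^bsub>?D\<^esub> (a, b) = (\<ominus>\<^bsub>A\<^esub> a, \<ominus>\<^bsub>B\<^esub> b)" if "a \<in> carrier A" "b \<in> carrier B" for a b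
    by (rule D.minus_equality) (use that in \<open>simp_all add: D f.R.l_neg g.R.l_neg\<close>)
  have "subring ?H ?D"
  proof (rule D.subringI)
    show "?H \<subseteq> carrier ?D" by (auto simp: D)
    show "\<one>\<^bsub>?D\<^esub> \<in> ?H" by (simp add: D)
    fix x assume "x \<in> ?H"
    then obtain a b where x: "x = (a, b)" "a \<in> carrier A" "b \<in> carrier B" "f a = g b" by blast
    show "\<ominus>\<^bsub>?D\<^esub> x \<in> ?H" using x by (simp add: neg)
    fix y assume "y \<in> ?H"
    then obtain a' b' where y: "y = (a', b')" "a' \<in> carrier A" "b' \<in> carrier B" "f a' = g b'" by blast
    show "x \<otimes>\<^bsub>?D\<^esub> y \<in> ?H" "x \<oplus>\<^bsub>?D\<^esub> y \<in> ?H" using x y by (simp_all add: D)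
  qed
  thus ?thesis unfolding fibre_product_def by (rule D.subring_is_ring)
qed

text \<open>The elements of the fibre product of \<open>k + I\<close> and \<open>k + J\<close> are the pairs \<open>(c + a, c + b)\<close> with \<open>c\<close> in \<open>k\<close>,
\<open>a\<close> in \<open>I\<close> and \<open>b\<close> in \<open>J\<close>. Sending such a pair to \<open>c + a + b\<close> respects products because \<open>I J = 0\<close>, is onto
because \<open>I + J = m\<close>, and has as kernel the pairs \<open>(a, - a)\<close> with \<open>a\<close> in \<open>I \<inter> J\<close>, the line spanned by
\<open>(\<delta>, - \<delta>)\<close>.\<close>

lemma is_connected_sum_of_orthogonal_ideals:
  fixes R :: "('a, 'b) ring_scheme" (structure)
  assumes "orthogonal_ideals R m \<delta> k I J" and K: "ring K"
    and h: "h \<in> ring_iso (R\<lparr>carrier := k\<rparr>) K"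
  shows "is_connected_sum K R (R\<lparr>carrier := orthogonal_ideals.kI R m k I\<rparr>)
           (R\<lparr>carrier := orthogonal_ideals.kI R m k J\<rparr>)"
proof -
  interpret orthogonal_ideals R m \<delta> k I J by fact
  interpret SW: orthogonal_ideals R m \<delta> k J I by (rule swap)
  let ?S = "SW.kI"
  let ?\<pi> = "h \<circ> coef"
  let ?P = "fibre_product kI_ring ?\<pi> SW.kI_ring ?\<pi>"
  have hinj: "inj_on h k" using ring_iso_memE(5)[OF h] unfolding bij_betw_def by simp
  note P = fibre_product_simps[of kI_ring ?\<pi> SW.kI_ring ?\<pi>, simplified]
  have Pmem: "(r, s) \<in> carrier ?P \<longleftrightarrow> r \<in> kI \<and> s \<in> ?S \<and> coef r = coef s" for r s
  proof -
    have "h (coef r) = h (coef s) \<longleftrightarrow> coef r = coef s" if "r \<in> kI" "s \<in> ?S"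
      using inj_on_eq_iff[OF hinj coef_props(1)[OF kI_carr[OF that(1)]] coef_props(1)[OF SW.kI_carr[OF that(2)]]] .
    thus ?thesis by (auto simp: P)
  qed
  have res: "residue_map K kI_ring ?\<pi>" "residue_map K SW.kI_ring ?\<pi>"
    by (rule kI_ring_residue_map[OF h], rule SW.kI_ring_residue_map[OF h])
  have ring: "ring ?P"
    by (rule fibre_product_ring;
        rule ring_hom_ringI2[OF _ K], use res kI_ring.ring_axioms SW.kI_ring.ring_axioms in \<open>simp_all add: residue_map_def\<close>)
  interpret P: ring ?P by (rule ring)
  define \<Psi> where "\<Psi> = (\<lambda>(r, s). r \<oplus> s \<ominus> coef r)"
  have decomp: "\<exists>c a b. c \<in> k \<and> a \<in> I \<and> b \<in> J \<and> x = (c \<oplus> a, c \<oplus> b) \<and> \<Psi> x = c \<oplus> (a \<oplus> b) \<and>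
      c \<in> carrier R \<and> a \<in> carrier R \<and> b \<in> carrier R" if "x \<in> carrier ?P" for x
  proof -
    obtain r s where x: "x = (r, s)" by (cases x)
    with that have rs: "r \<in> kI" "s \<in> ?S" "coef r = coef s" using Pmem by auto
    let ?c = "coef r" and ?a = "r \<ominus> coef r" and ?b = "s \<ominus> coef s"
    have rc: "r \<in> carrier R" "s \<in> carrier R" using rs kI_carr SW.kI_carr by auto
    have c: "?c \<in> carrier R" "coef s \<in> carrier R" using rc by auto
    have ab: "?a \<in> I" "?b \<in> J" using rs unfolding kI_def SW.kI_def by auto
    have "r = ?c \<oplus> ?a" using rc c by algebra
    moreover have "s = coef s \<oplus> ?b" using rc c by algebra
    moreover have "\<Psi> x = ?c \<oplus> (?a \<oplus> ?b)"
    proof -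
      have "\<Psi> x = r \<oplus> s \<ominus> coef r" unfolding \<Psi>_def x by simp
      also have "\<dots> = ?c \<oplus> (?a \<oplus> (s \<ominus> coef r))" using rc c by algebra
      finally show ?thesis using rs(3) by simp
    qed
    ultimately show ?thesis using coef_props(1)[OF rc(1)] ab c rc x rs(3) by (intro exI[of _ ?c] exI[of _ ?a] exI[of _ ?b]) auto
  qed
  have mem: "(c \<oplus> a, c \<oplus> b) \<in> carrier ?P \<and> \<Psi> (c \<oplus> a, c \<oplus> b) = c \<oplus> (a \<oplus> b)"
    if "c \<in> k" "a \<in> I" "b \<in> J" for c a b
  proof -
    have cr: "c \<in> carrier R" "a \<in> carrier R" "b \<in> carrier R" using that I.Icarr J.Icarr by auto
    have e: "c \<oplus> a \<ominus> c = a" "c \<oplus> b \<ominus> c = b" using cr by algebra+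
    have coef: "coef (c \<oplus> a) = c" "coef (c \<oplus> b) = c"
      using coef_eqI[of "c \<oplus> a" c] coef_eqI[of "c \<oplus> b" c] e that cr by simp_all
    have "c \<oplus> a \<in> kI" "c \<oplus> b \<in> ?S" unfolding kI_iff SW.kI_iff using that by blast+
    moreover have "(c \<oplus> a) \<oplus> (c \<oplus> b) \<ominus> c = c \<oplus> (a \<oplus> b)" using cr by algebra
    ultimately show ?thesis unfolding Pmem \<Psi>_def by (simp add: coef)
  qed
  have hom: "ring_hom_ring ?P R \<Psi>"
  proof (rule ring_hom_ringI[OF ring ring_axioms])
    fix x assume x: "x \<in> carrier ?P"
    obtain c a b where ca: "c \<in> k" "a \<in> I" "b \<in> J" "x = (c \<oplus> a, c \<oplus> b)" "\<Psi> x = c \<oplus> (a \<oplus> b)"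
      and cr: "c \<in> carrier R" "a \<in> carrier R" "b \<in> carrier R" using decomp[OF x] by blast
    show "\<Psi> x \<in> carrier R" unfolding ca(5) using cr by simp
    fix y assume y: "y \<in> carrier ?P"
    obtain d e f where de: "d \<in> k" "e \<in> I" "f \<in> J" "y = (d \<oplus> e, d \<oplus> f)" "\<Psi> y = d \<oplus> (e \<oplus> f)"
      and dr: "d \<in> carrier R" "e \<in> carrier R" "f \<in> carrier R" using decomp[OF y] by blast
    have "x \<oplus>\<^bsub>?P\<^esub> y = ((c \<oplus> d) \<oplus> (a \<oplus> e), (c \<oplus> d) \<oplus> (b \<oplus> f))"
      unfolding ca(4) de(4) P using cr dr by (auto simp: a_ac)
    moreover have "\<Psi> ((c \<oplus> d) \<oplus> (a \<oplus> e), (c \<oplus> d) \<oplus> (b \<oplus> f)) = (c \<oplus> d) \<oplus> ((a \<oplus> e) \<oplus> (b \<oplus> f))"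
      using mem[OF k_props(7)[OF ca(1) de(1)] I.a_closed[OF ca(2) de(2)] J.a_closed[OF ca(3) de(3)]] by simp
    moreover have "(c \<oplus> d) \<oplus> ((a \<oplus> e) \<oplus> (b \<oplus> f)) = \<Psi> x \<oplus> \<Psi> y"
      unfolding ca(5) de(5) using cr dr by algebra
    ultimately show "\<Psi> (x \<oplus>\<^bsub>?P\<^esub> y) = \<Psi> x \<oplus> \<Psi> y" by simp
    \<comment> \<open>The cross terms \<open>a f\<close> and \<open>e b\<close> are products of elements of \<open>I\<close> and \<open>J\<close>.\<close>
    let ?i = "c \<otimes> e \<oplus> d \<otimes> a \<oplus> a \<otimes> e" and ?j = "c \<otimes> f \<oplus> d \<otimes> b \<oplus> b \<otimes> f"
    have ij: "?i \<in> I" "?j \<in> J"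
      using I.I_l_closed[OF de(2) cr(1)] I.I_l_closed[OF ca(2) dr(1)] I.I_l_closed[OF de(2) cr(2)]
        J.I_l_closed[OF de(3) cr(1)] J.I_l_closed[OF ca(3) dr(1)] J.I_l_closed[OF de(3) cr(3)] by auto
    have "(c \<oplus> a) \<otimes> (d \<oplus> e) = c \<otimes> d \<oplus> ?i" "(c \<oplus> b) \<otimes> (d \<oplus> f) = c \<otimes> d \<oplus> ?j"
      using cr dr by algebra+
    hence "x \<otimes>\<^bsub>?P\<^esub> y = (c \<otimes> d \<oplus> ?i, c \<otimes> d \<oplus> ?j)" unfolding ca(4) de(4) P by simp
    hence "\<Psi> (x \<otimes>\<^bsub>?P\<^esub> y) = c \<otimes> d \<oplus> (?i \<oplus> ?j)"
      using mem[OF k_props(6)[OF ca(1) de(1)] ij] by simp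
    also have "\<dots> = \<Psi> x \<otimes> \<Psi> y \<ominus> a \<otimes> f \<ominus> e \<otimes> b"
      unfolding ca(5) de(5) using cr dr by algebra
    also have "\<dots> = \<Psi> x \<otimes> \<Psi> y"
      using orth[OF ca(2) de(3)] orth[OF de(2) ca(3)] cr dr unfolding ca(5) de(5) by (simp add: a_minus_def)
    finally show "\<Psi> (x \<otimes>\<^bsub>?P\<^esub> y) = \<Psi> x \<otimes> \<Psi> y" .
  next
    have "\<Psi> (\<one> \<oplus> \<zero>, \<one> \<oplus> \<zero>) = \<one> \<oplus> (\<zero> \<oplus> \<zero>)"
      using mem[OF k_props(3) I.zero_closed J.zero_closed] by simp
    thus "\<Psi> \<one>\<^bsub>?P\<^esub> = \<one>" unfolding P by simp
  qed
  interpret \<Psi>: ring_hom_ring ?P R \<Psi> by (rule hom)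
  have surj: "\<Psi> ` carrier ?P = carrier R"
  proof (intro equalityI subsetI)
    fix x assume x: "x \<in> carrier R"
    obtain a b where ab: "a \<in> I" "b \<in> J" "x \<ominus> coef x = a \<oplus> b" using sum[OF coef_props(2)[OF x]] by blast
    have "x = coef x \<oplus> (x \<ominus> coef x)" using x coef_carr[OF x] by algebra
    hence "x = \<Psi> (coef x \<oplus> a, coef x \<oplus> b)" using mem[OF coef_props(1)[OF x] ab(1,2)] ab(3) by simp
    thus "x \<in> \<Psi> ` carrier ?P" using mem[OF coef_props(1)[OF x] ab(1,2)] by blast
  qed auto
  have delta_J: "\<delta> \<in> J" by (rule SW.delta_I)
  have gen: "(\<delta>, \<zero>\<^bsub>SW.kI_ring\<^esub>) \<ominus>\<^bsub>?P\<^esub> (\<zero>\<^bsub>kI_ring\<^esub>, \<delta>) = (\<delta>, \<ominus> \<delta>)"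
  proof -
    have m1: "(\<delta>, \<zero>) \<in> carrier ?P" "(\<zero>, \<delta>) \<in> carrier ?P" "(\<zero>, \<ominus> \<delta>) \<in> carrier ?P"
      unfolding Pmem using I_sub_kI[OF delta_I] SW.I_sub_kI[OF delta_J] SW.I_sub_kI[OF J.a_inv_closed[OF delta_J]] delta_I delta_J
      by (auto simp: coef_m)
    have "\<ominus>\<^bsub>?P\<^esub> (\<zero>, \<delta>) = (\<zero>, \<ominus> \<delta>)"
      by (rule P.minus_equality[OF _ m1(2,3)]) (use delta_carr in \<open>simp add: P l_neg\<close>)
    thus ?thesis using delta_carr by (simp add: a_minus_def P)
  qed
  have ker: "a_kernel ?P R \<Psi> = PIdl\<^bsub>?P\<^esub> (\<delta>, \<ominus> \<delta>)"
  proof (intro equalityI subsetI)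
    fix x assume "x \<in> a_kernel ?P R \<Psi>"
    hence x: "x \<in> carrier ?P" "\<Psi> x = \<zero>" unfolding a_kernel_def' by auto
    obtain c a b where ca: "c \<in> k" "a \<in> I" "b \<in> J" "x = (c \<oplus> a, c \<oplus> b)" "\<Psi> x = c \<oplus> (a \<oplus> b)"
      and cr: "c \<in> carrier R" "a \<in> carrier R" "b \<in> carrier R" using decomp[OF x(1)] by blast
    have "c = \<ominus> (a \<oplus> b) \<oplus> \<Psi> x" unfolding ca(5) using cr by algebra
    hence "c = \<ominus> (a \<oplus> b)" using x(2) cr by simp
    moreover have "\<ominus> (a \<oplus> b) \<in> m" using ca by (intro m.a_inv_closed m.a_closed) auto
    ultimately have c0: "c = \<zero>" using k_inter_m[OF ca(1)] by simp
    have "b = \<ominus> a \<oplus> (\<Psi> x \<ominus> c)" unfolding ca(5) using cr by algebra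
    hence b: "b = \<ominus> a" using x(2) c0 cr by (simp add: a_minus_def)
    hence "a = \<ominus> b" using cr by simp
    hence "a \<in> J" using J.a_inv_closed[OF ca(3)] by simp
    hence "a \<in> socle R" using ca(2) inter by blast
    then obtain d where d: "d \<in> k" "a = d \<otimes> \<delta>" unfolding socle_line by blast
    have "b = d \<otimes> \<ominus> \<delta>" unfolding b d(2) using k_carr[OF d(1)] delta_carr by (simp add: r_minus)
    hence "x = (d, d) \<otimes>\<^bsub>?P\<^esub> (\<delta>, \<ominus> \<delta>)" unfolding ca(4) c0 P using cr d(2) by simp
    moreover have "(d, d) \<in> carrier ?P" unfolding Pmem using k_sub_kI[OF d(1)] SW.k_sub_kI[OF d(1)] by simp
    ultimately show "x \<in> PIdl\<^bsub>?P\<^esub> (\<delta>, \<ominus> \<delta>)" unfolding cgenideal_def by blast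
  next
    fix x assume "x \<in> PIdl\<^bsub>?P\<^esub> (\<delta>, \<ominus> \<delta>)"
    then obtain t where t: "t \<in> carrier ?P" "x = t \<otimes>\<^bsub>?P\<^esub> (\<delta>, \<ominus> \<delta>)" unfolding cgenideal_def by blast
    have "(\<zero> \<oplus> \<delta>, \<zero> \<oplus> \<ominus> \<delta>) \<in> carrier ?P \<and> \<Psi> (\<zero> \<oplus> \<delta>, \<zero> \<oplus> \<ominus> \<delta>) = \<zero> \<oplus> (\<delta> \<oplus> \<ominus> \<delta>)"
      by (rule mem[OF k_props(2) delta_I J.a_inv_closed[OF delta_J]])
    hence g: "(\<delta>, \<ominus> \<delta>) \<in> carrier ?P" "\<Psi> (\<delta>, \<ominus> \<delta>) = \<zero>" using delta_carr by (auto simp: r_neg)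
    have "\<Psi> x = \<zero>" unfolding t(2) using \<Psi>.hom_mult[OF t(1) g(1)] g(2) \<Psi>.hom_closed[OF t(1)] by simp
    moreover have "x \<in> carrier ?P" unfolding t(2) by (rule P.m_closed[OF t(1) g(1)])
    ultimately show "x \<in> a_kernel ?P R \<Psi>" unfolding a_kernel_def' by simp
  qed
  have "ring (?P Quot a_kernel ?P R \<Psi>)" by (rule ideal.quotient_is_ring[OF \<Psi>.kernel_is_ideal])
  hence iso: "R \<simeq> ?P Quot a_kernel ?P R \<Psi>" using \<Psi>.FactRing_iso[OF surj] by (rule ring_iso_sym)
  have cs: "connected_sum kI_ring ?\<pi> \<delta> SW.kI_ring ?\<pi> \<delta> = ?P Quot a_kernel ?P R \<Psi>"
    unfolding connected_sum_def Let_def gen ker ..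
  have "\<delta> \<noteq> \<zero>" by (rule delta_nz)
  hence nz: "max_ideal kI_ring \<noteq> {\<zero>\<^bsub>kI_ring\<^esub>}" "max_ideal SW.kI_ring \<noteq> {\<zero>\<^bsub>SW.kI_ring\<^esub>}"
    unfolding kI_ring_max_ideal SW.kI_ring_max_ideal using delta_I delta_J by auto
  show ?thesis
    unfolding is_connected_sum_def
  proof (intro conjI kI_ring_gorenstein SW.kI_ring_gorenstein nz)
    show "\<exists>\<pi>\<^sub>R \<pi>\<^sub>S. \<exists>\<delta>\<^sub>R\<in>carrier kI_ring. \<exists>\<delta>\<^sub>S\<in>carrier SW.kI_ring. residue_map K kI_ring \<pi>\<^sub>R \<and> residue_map K SW.kI_ring \<pi>\<^sub>S \<and>
        socle kI_ring = PIdl\<^bsub>kI_ring\<^esub> \<delta>\<^sub>R \<and> socle SW.kI_ring = PIdl\<^bsub>SW.kI_ring\<^esub> \<delta>\<^sub>S \<and>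
        R \<simeq> connected_sum kI_ring \<pi>\<^sub>R \<delta>\<^sub>R SW.kI_ring \<pi>\<^sub>S \<delta>\<^sub>S"
      using res kI_ring_socle_gen SW.kI_ring_socle_gen iso cs I_sub_kI[OF delta_I] SW.I_sub_kI[OF delta_J]
      by (intro exI[of _ ?\<pi>] bexI[of _ \<delta>]) simp_all
  qed
qed

lemma decomposes_of_orthogonal_ideals:
  fixes R :: "'a ring"
  assumes "orthogonal_ideals R m \<delta> k I J" and "ring K"
    and "h \<in> ring_iso (R\<lparr>carrier := k\<rparr>) K"
  shows "decomposes_as_connected_sum K R"
proof -
  interpret orthogonal_ideals R m \<delta> k I J by fact
  interpret SW: orthogonal_ideals R m \<delta> k J I by (rule swap)
  show ?thesis
    unfolding decomposes_as_connected_sum_def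
    using is_connected_sum_of_orthogonal_ideals[OF assms] kI_ring_loewy_length SW.kI_ring_loewy_length
      kI_ring_not_iso SW.kI_ring_not_iso by blast
qed

text \<open>Two ideals that split \<open>m\<close> modulo the socle may have a nonzero product inside the socle. They are
replaced by an ideal \<open>A\<close> and its annihilator, whose product is zero by construction; which \<open>A\<close> is taken
depends on whether \<open>ann_sq\<close> annihilates itself.\<close>

lemma (in long_gorenstein_algebra) orthogonal_ideals_exist:
  assumes I: "ideal I R" and J: "ideal J R"
    and inter: "I \<inter> J = socle R"
    and sum: "\<And>x. x \<in> m \<Longrightarrow> \<exists>a\<in>I. \<exists>b\<in>J. x = a \<oplus> b"
    and Im: "I \<subseteq> m" and Jm: "J \<subseteq> m" and Isoc: "I \<noteq> socle R" and Jsoc: "J \<noteq> socle R"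
  shows "\<exists>A B. orthogonal_ideals R m \<delta> k A B"
proof -
  obtain A where A: "ideal A R" "A \<inter> annihilator R A = socle R" "A \<noteq> socle R" "annihilator R A \<noteq> socle R"
  proof (cases "ann_sq \<subseteq> annihilator R ann_sq")
    case True
    show ?thesis
      by (rule that[OF I splitting_of_separated_ideals(1)[OF I J inter sum Im Jm Jsoc Isoc True] Isoc
            splitting_of_separated_ideals(2)[OF I J inter sum Im Jm Jsoc Isoc True]])
  next
    case False
    then obtain x where "x \<in> ann_sq" "x \<notin> annihilator R ann_sq" by blast
    thus ?thesis by (rule splitting_in_ann_sq) (rule that)
  qed
  have "orthogonal_ideals R m \<delta> k A (annihilator R A)"
  proof (intro orthogonal_ideals.intro orthogonal_ideals_axioms.intro gorenstein_algebra_axioms)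
    have B: "ideal (annihilator R A) R" by (rule ann_ideal[OF A(1)])
    show "A \<subseteq> m"
    proof (rule proper_ideal_in_m[OF A(1)], rule notI)
      assume "\<one> \<in> A"
      hence "A = carrier R" by (rule ideal.one_imp_carrier[OF A(1)])
      hence "annihilator R A = socle R" using A(2) additive_subgroup.a_subset[OF ideal.axioms(1)[OF B]] by blast
      thus False using A(4) by blast
    qed
    show "annihilator R A \<subseteq> m"
    proof (rule proper_ideal_in_m[OF B], rule notI)
      assume "\<one> \<in> annihilator R A"
      hence "annihilator R A = carrier R" by (rule ideal.one_imp_carrier[OF B])
      hence "A = socle R" using A(2) additive_subgroup.a_subset[OF ideal.axioms(1)[OF A(1)]] by blast
      thus False using A(3) by blast
    qed
    show "a \<otimes> b = \<zero>" if "a \<in> A" "b \<in> annihilator R A" for a b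
      using annihilatorD[OF that(2,1)] m_comm[OF ideal.Icarr[OF A(1) that(1)] annihilator_carr[OF that(2)]] by simp
    show "\<exists>a\<in>A. \<exists>b\<in>annihilator R A. x = a \<oplus> b" if "x \<in> m" for x
      by (rule ideal_add_annihilator[OF A(1,2) that])
  qed (rule A ann_ideal[OF A(1)])+
  thus ?thesis by blast
qed

section \<open>Graded algebras and quotients by the socle\<close>

context graded_algebra begin

lemma gr_carr: "x \<in> gr i \<Longrightarrow> x \<in> carrier G"
  using additive_subgroup.a_Hcarr[OF gr_subgroup] .

text \<open>All components of \<open>x y\<close> have degree at least \<open>i\<close>, but \<open>\<one>\<close> is homogeneous of degree zero; by uniqueness
of components both vanish.\<close>

lemma homogeneous_nonunit:
  assumes x: "x \<in> gr i" and i: "0 < i" and y: "y \<in> carrier G" and xy: "x \<otimes>\<^bsub>G\<^esub> y = \<one>\<^bsub>G\<^esub>"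
  shows "\<one>\<^bsub>G\<^esub> = \<zero>\<^bsub>G\<^esub>"
proof (rule ccontr)
  assume nz: "\<one>\<^bsub>G\<^esub> \<noteq> \<zero>\<^bsub>G\<^esub>"
  have xc: "x \<in> carrier G" by (rule gr_carr[OF x])
  obtain f where f: "\<forall>j. f j \<in> gr j" and fin: "finite {j. f j \<noteq> \<zero>\<^bsub>G\<^esub>}"
    and sum: "y = finsum G f {j. f j \<noteq> \<zero>\<^bsub>G\<^esub>}"
    using ex1_implies_ex[OF gr_direct_sum[OF y]] by (elim exE conjE)
  let ?A = "{j. f j \<noteq> \<zero>\<^bsub>G\<^esub>}"
  \<comment> \<open>The families of components of \<open>x y\<close> and of \<open>\<one>\<close>.\<close>
  define g where "g n = (if i \<le> n then x \<otimes>\<^bsub>G\<^esub> f (n - i) else \<zero>\<^bsub>G\<^esub>)" for n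
  define h where "h n = (if n = 0 then \<one>\<^bsub>G\<^esub> else \<zero>\<^bsub>G\<^esub>)" for n :: nat
  have fc: "f j \<in> carrier G" for j using f gr_carr by blast
  have zero: "\<zero>\<^bsub>G\<^esub> \<in> gr n" for n by (rule additive_subgroup.zero_closed[OF gr_subgroup])
  have ggr: "g n \<in> gr n" for n
  proof (cases "i \<le> n")
    case True
    thus ?thesis using gr_mult[OF x f[rule_format, of "n - i"]] unfolding g_def by simp
  qed (simp add: g_def zero)
  have gc: "g n \<in> carrier G" for n using ggr gr_carr by blast
  have supp: "{n. g n \<noteq> \<zero>\<^bsub>G\<^esub>} \<subseteq> (\<lambda>j. j + i) ` ?A"
  proof
    fix n assume "n \<in> {n. g n \<noteq> \<zero>\<^bsub>G\<^esub>}"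
    hence "i \<le> n" "f (n - i) \<noteq> \<zero>\<^bsub>G\<^esub>" unfolding g_def using xc by (auto split: if_splits)
    thus "n \<in> (\<lambda>j. j + i) ` ?A" by (intro image_eqI[of _ _ "n - i"]) auto
  qed
  have "\<one>\<^bsub>G\<^esub> = finsum G (\<lambda>j. x \<otimes>\<^bsub>G\<^esub> f j) ?A"
    using G.finsum_rdistr[OF fin xc, of f] fc xy unfolding sum by simp
  also have "\<dots> = finsum G (\<lambda>j. g (j + i)) ?A" unfolding g_def by simp
  also have "\<dots> = finsum G g ((\<lambda>j. j + i) ` ?A)"
    by (rule G.add.finprod_reindex[symmetric]) (use gc in auto)
  also have "\<dots> = finsum G g {n. g n \<noteq> \<zero>\<^bsub>G\<^esub>}"
    by (rule G.add.finprod_mono_neutral_cong_right[OF finite_imageI[OF fin] supp]) (use gc in auto)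
  finally have one_g: "\<one>\<^bsub>G\<^esub> = finsum G g {n. g n \<noteq> \<zero>\<^bsub>G\<^esub>}" .
  have "\<one>\<^bsub>G\<^esub> \<in> gr 0"
    using ring_hom_one[OF unit_hom] unit_bij one_closed unfolding bij_betw_def by (metis imageI)
  hence hgr: "h n \<in> gr n" for n unfolding h_def using zero by simp
  have hsupp: "{n. h n \<noteq> \<zero>\<^bsub>G\<^esub>} = {0}" unfolding h_def using nz by auto
  have "finsum G h {0} = \<one>\<^bsub>G\<^esub>" by (simp add: h_def)
  hence one_h: "\<one>\<^bsub>G\<^esub> = finsum G h {n. h n \<noteq> \<zero>\<^bsub>G\<^esub>}" unfolding hsupp by simp
  have "g = h"
  proof (rule ex1E[OF gr_direct_sum[OF G.one_closed]])
    fix u assume u: "\<forall>v. (\<forall>i. v i \<in> gr i) \<and> finite {i. v i \<noteq> \<zero>\<^bsub>G\<^esub>} \<and>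
        \<one>\<^bsub>G\<^esub> = finsum G v {i. v i \<noteq> \<zero>\<^bsub>G\<^esub>} \<longrightarrow> v = u"
    have "g = u" by (rule u[rule_format]) (intro conjI allI ggr finite_subset[OF supp finite_imageI[OF fin]] one_g)
    moreover have "h = u" by (rule u[rule_format], intro conjI allI hgr one_h) (simp add: hsupp)
    ultimately show ?thesis by simp
  qed
  hence "g 0 = h 0" by simp
  thus False using nz i unfolding g_def h_def by simp
qed

lemma unit_iso: "\<iota> \<in> ring_iso K (G\<lparr>carrier := gr 0\<rparr>)"
proof (rule ring_iso_memI)
  have "\<iota> ` carrier K = gr 0" using unit_bij unfolding bij_betw_def by simp
  thus "\<iota> x \<in> carrier (G\<lparr>carrier := gr 0\<rparr>)" if "x \<in> carrier K" for x using that by auto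
qed (use ring_hom_mult[OF unit_hom] ring_hom_add[OF unit_hom] ring_hom_one[OF unit_hom] unit_bij in auto)

text \<open>Positive degree components consist of nonunits, so they lie in the maximal ideal: modulo it, every
element is congruent to its component of degree zero.\<close>

lemma gorenstein_algebra_of_graded:
  assumes "gorenstein_artin_local G"
  shows "\<exists>\<delta>. gorenstein_algebra G (max_ideal G) \<delta> (gr 0)"
proof -
  have loc: "local_ring G" and art: "artinian_ring G"
    using assms unfolding gorenstein_artin_local_def by auto
  from assms obtain \<delta> where \<delta>: "\<delta> \<in> carrier G" "\<delta> \<noteq> \<zero>\<^bsub>G\<^esub>" "socle G = PIdl\<^bsub>G\<^esub> \<delta>"
    unfolding gorenstein_artin_local_def by blast
  interpret L: artin_local G "max_ideal G"
    by (intro artin_local.intro local_ring_imp_local_cring[OF loc] artin_local_axioms.intro art)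
  interpret m: ideal "max_ideal G" G by (rule L.m_ideal)
  have nz: "\<one>\<^bsub>G\<^esub> \<noteq> \<zero>\<^bsub>G\<^esub>" using L.one_notin_m m.zero_closed by metis
  interpret h: ring_hom_ring K G \<iota> by (rule ring_hom_ringI2[OF ring_axioms G.ring_axioms unit_hom])
  have img: "\<iota> ` carrier K = gr 0" using unit_bij unfolding bij_betw_def by simp
  have sub: "subfield (gr 0) G"
    using h.img_is_subfield(2)[OF carrier_is_subfield nz] unfolding img .
  have pos: "x \<in> max_ideal G" if x: "x \<in> gr i" "0 < i" for x i
  proof (rule ccontr)
    assume "x \<notin> max_ideal G"
    then obtain y where "y \<in> carrier G" "x \<otimes>\<^bsub>G\<^esub> y = \<one>\<^bsub>G\<^esub>"
      using L.unit_outside_m[OF gr_carr[OF x(1)]] by blast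
    thus False using homogeneous_nonunit[OF x] nz by blast
  qed
  interpret g0: additive_subgroup "gr 0" G by (rule gr_subgroup)
  have coeff: "\<exists>c\<in>gr 0. x \<ominus>\<^bsub>G\<^esub> c \<in> max_ideal G" if x: "x \<in> carrier G" for x
  proof -
    obtain f where f: "\<forall>j. f j \<in> gr j" and fin: "finite {j. f j \<noteq> \<zero>\<^bsub>G\<^esub>}"
      and sum: "x = finsum G f {j. f j \<noteq> \<zero>\<^bsub>G\<^esub>}"
      using ex1_implies_ex[OF gr_direct_sum[OF x]] by (elim exE conjE)
    have fc: "f j \<in> carrier G" for j using f gr_carr by blast
    have "\<exists>c\<in>gr 0. finsum G f A \<ominus>\<^bsub>G\<^esub> c \<in> max_ideal G" if "finite A" for A
      using that
    proof (induction A)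
      case empty
      show ?case by (rule bexI[of _ "\<zero>\<^bsub>G\<^esub>"]) (simp_all add: a_minus_def)
    next
      case (insert j A)
      then obtain c where c: "c \<in> gr 0" "finsum G f A \<ominus>\<^bsub>G\<^esub> c \<in> max_ideal G" by blast
      have cc: "c \<in> carrier G" "finsum G f A \<in> carrier G"
        using gr_carr[OF c(1)] fc by (auto intro: G.finsum_closed)
      have e: "finsum G f (insert j A) = f j \<oplus>\<^bsub>G\<^esub> finsum G f A"
        using insert fc by (intro G.finsum_insert) auto
      show ?case
      proof (cases "j = 0")
        case True
        have "(f j \<oplus>\<^bsub>G\<^esub> finsum G f A) \<ominus>\<^bsub>G\<^esub> (f j \<oplus>\<^bsub>G\<^esub> c) = finsum G f A \<ominus>\<^bsub>G\<^esub> c"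
          using cc fc[of j] by algebra
        moreover have "f j \<oplus>\<^bsub>G\<^esub> c \<in> gr 0" using True f c(1) by blast
        ultimately show ?thesis unfolding e using c(2) by (intro bexI[of _ "f j \<oplus>\<^bsub>G\<^esub> c"]) simp_all
      next
        case False
        have "(f j \<oplus>\<^bsub>G\<^esub> finsum G f A) \<ominus>\<^bsub>G\<^esub> c = f j \<oplus>\<^bsub>G\<^esub> (finsum G f A \<ominus>\<^bsub>G\<^esub> c)"
          using cc fc[of j] by algebra
        moreover have "f j \<in> max_ideal G" using pos[of "f j" j] f False by simp
        ultimately show ?thesis unfolding e using c m.a_closed by (intro bexI[of _ c]) simp_all
      qed
    qed
    thus ?thesis unfolding sum using fin by blast
  qed
  show ?thesis
    by (intro exI[of _ \<delta>] gorenstein_algebra.intro gorenstein_algebra_axioms.intro L.artin_local_axioms \<delta> sub coeff)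
qed

end

lemma (in gorenstein_algebra) long_gorenstein_algebra:
  assumes "3 \<le> loewy_length R"
  shows "long_gorenstein_algebra R m \<delta> k"
  by (intro long_gorenstein_algebra.intro gorenstein_algebra_axioms long_gorenstein_algebra_axioms.intro
      loewy_length_ge_3_imp assms)

text \<open>The socle is contained in \<open>m\<close>, so the quotient has the same residue field, and its natural projection
is the constant term of a representative, transported along \<open>\<iota>\<close>. Its maximal ideal \<open>m / soc\<close> is not
zero, as \<open>m\<^sup>3 \<noteq> 0\<close>.\<close>

lemma (in long_gorenstein_algebra) quotient_by_socle:
  assumes \<iota>: "\<iota> \<in> ring_iso K (R\<lparr>carrier := k\<rparr>)" and K: "ring K"
  defines "Rb \<equiv> R Quot socle R"
  defines "\<pi> \<equiv> residue_proj K Rb (quot_unit R (socle R) \<iota>)"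
  shows "local_cring Rb (max_ideal Rb)"
    and "\<pi> \<in> ring_hom Rb K"
    and "\<And>x. x \<in> carrier Rb \<Longrightarrow> \<pi> x = \<zero>\<^bsub>K\<^esub> \<longleftrightarrow> x \<in> max_ideal Rb"
    and "\<exists>x\<in>max_ideal Rb. x \<noteq> \<zero>\<^bsub>Rb\<^esub>"
proof -
  interpret soc: ideal "socle R" R by (rule socle_ideal)
  interpret m: ideal m R by (rule m_ideal)
  let ?q = "(+>) (socle R)"
  interpret q: ring_hom_cring R Rb ?q
    unfolding Rb_def by (rule soc.rcos_ring_hom_cring[OF is_cring])
  have surj: "carrier Rb = ?q ` carrier R"
    unfolding Rb_def FactRing_def A_RCOSETS_def' by auto
  have q_eq: "?q x = ?q y \<longleftrightarrow> x \<ominus> y \<in> socle R" if "x \<in> carrier R" "y \<in> carrier R" for x y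
    using quotient_eq_iff_same_a_r_cos[OF socle_ideal that] by simp
  have q_in: "?q x \<in> ?q ` m \<longleftrightarrow> x \<in> m" if x: "x \<in> carrier R" for x
  proof
    assume "?q x \<in> ?q ` m"
    then obtain y where y: "y \<in> m" "?q x = ?q y" by blast
    hence "x \<ominus> y \<in> m" using q_eq[OF x m_carr[OF y(1)]] socle_in_m by blast
    hence "(x \<ominus> y) \<oplus> y \<in> m" using y(1) by simp
    moreover have "(x \<ominus> y) \<oplus> y = x" using x m_carr[OF y(1)] by algebra
    ultimately show "x \<in> m" by simp
  qed simp
  have loc: "local_cring Rb (?q ` m)"
  proof (intro local_cring.intro local_cring_axioms.intro)
    show "cring Rb" by (rule q.S.is_cring)
    show "ideal (?q ` m) Rb" unfolding Rb_def by (rule ring_ideal_imp_quot_ideal[OF socle_ideal m_ideal])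
    show "\<one>\<^bsub>Rb\<^esub> \<notin> ?q ` m" using q_in[OF one_closed] one_notin_m by simp
    fix x assume x: "x \<in> carrier Rb" "x \<notin> ?q ` m"
    then obtain z where z: "z \<in> carrier R" "x = ?q z" unfolding surj by blast
    hence "z \<notin> m" using x(2) by blast
    then obtain y where y: "y \<in> carrier R" "z \<otimes> y = \<one>" using unit_outside_m[OF z(1)] by blast
    have "x \<otimes>\<^bsub>Rb\<^esub> ?q y = \<one>\<^bsub>Rb\<^esub>" using q.hom_mult[OF z(1) y(1)] y(2) z(2) by simp
    thus "\<exists>y\<in>carrier Rb. x \<otimes>\<^bsub>Rb\<^esub> y = \<one>\<^bsub>Rb\<^esub>" using y(1) by (intro bexI[of _ "?q y"]) simp_all
  qed
  have max: "max_ideal Rb = ?q ` m" by (rule local_cring.max_ideal_eq[OF loc])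
  show "local_cring Rb (max_ideal Rb)" unfolding max by (rule loc)
  have bij: "bij_betw \<iota> (carrier K) k" using ring_iso_memE(5)[OF \<iota>] by simp
  let ?\<kappa> = "inv_into (carrier K) \<iota>"
  have \<kappa>: "?\<kappa> c \<in> carrier K" "\<iota> (?\<kappa> c) = c" if "c \<in> k" for c
    using that bij unfolding bij_betw_def by (auto intro: inv_into_into f_inv_into_f)
  have \<kappa>_hom: "?\<kappa> \<in> ring_hom (R\<lparr>carrier := k\<rparr>) K"
    using ring_iso_set_sym[OF K \<iota>] unfolding ring_iso_def by simp
  have pi: "\<pi> (?q x) = ?\<kappa> (coef x)" if x: "x \<in> carrier R" for x
  proof -
    have iff: "?q x \<ominus>\<^bsub>Rb\<^esub> quot_unit R (socle R) \<iota> c \<in> max_ideal Rb \<longleftrightarrow> c = ?\<kappa> (coef x)" if c: "c \<in> carrier K" for c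
    proof -
      have ck: "\<iota> c \<in> k" using bij c unfolding bij_betw_def by blast
      have "?q x \<ominus>\<^bsub>Rb\<^esub> quot_unit R (socle R) \<iota> c = ?q (x \<ominus> \<iota> c)"
        unfolding quot_unit_def a_minus_def using x k_carr[OF ck] by simp
      hence e1: "?q x \<ominus>\<^bsub>Rb\<^esub> quot_unit R (socle R) \<iota> c \<in> max_ideal Rb \<longleftrightarrow> x \<ominus> \<iota> c \<in> m"
        unfolding max using q_in[of "x \<ominus> \<iota> c"] x k_carr[OF ck] by simp
      have e2: "x \<ominus> \<iota> c \<in> m \<longleftrightarrow> \<iota> c = coef x" using coef_eqI[OF x ck] coef_props(2)[OF x] by metis
      have e3: "\<iota> c = coef x \<longleftrightarrow> c = ?\<kappa> (coef x)"
        using \<kappa>[OF coef_props(1)[OF x]] bij_betw_inv_into_left[OF bij c] by metis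
      show ?thesis by (rule trans[OF e1 trans[OF e2 e3]])
    qed
    show ?thesis
      unfolding \<pi>_def residue_proj_def
      by (rule the_equality) (use iff \<kappa>[OF coef_props(1)[OF x]] in blast)+
  qed
  show "\<pi> \<in> ring_hom Rb K"
  proof (rule ring_hom_memI)
    fix u assume "u \<in> carrier Rb"
    then obtain x where x: "x \<in> carrier R" "u = ?q x" unfolding surj by blast
    show "\<pi> u \<in> carrier K" unfolding x(2) pi[OF x(1)] by (rule \<kappa>(1)[OF coef_props(1)[OF x(1)]])
    fix v assume "v \<in> carrier Rb"
    then obtain y where y: "y \<in> carrier R" "v = ?q y" unfolding surj by blast
    have xy: "u \<otimes>\<^bsub>Rb\<^esub> v = ?q (x \<otimes> y)" "u \<oplus>\<^bsub>Rb\<^esub> v = ?q (x \<oplus> y)"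
      unfolding x(2) y(2) using x(1) y(1) by simp_all
    show "\<pi> (u \<otimes>\<^bsub>Rb\<^esub> v) = \<pi> u \<otimes>\<^bsub>K\<^esub> \<pi> v"
      unfolding xy unfolding pi[OF m_closed[OF x(1) y(1)]] coef_mult[OF x(1) y(1)] x(2) y(2) pi[OF x(1)] pi[OF y(1)]
      using ring_hom_mult[OF \<kappa>_hom, of "coef x" "coef y"] coef_props(1) x(1) y(1) by simp
    show "\<pi> (u \<oplus>\<^bsub>Rb\<^esub> v) = \<pi> u \<oplus>\<^bsub>K\<^esub> \<pi> v"
      unfolding xy unfolding pi[OF a_closed[OF x(1) y(1)]] coef_add[OF x(1) y(1)] x(2) y(2) pi[OF x(1)] pi[OF y(1)]
      using ring_hom_add[OF \<kappa>_hom, of "coef x" "coef y"] coef_props(1) x(1) y(1) by simp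
  next
    have "\<pi> \<one>\<^bsub>Rb\<^esub> = ?\<kappa> \<one>" using pi[OF one_closed] coef_k[OF k_props(3)] by simp
    thus "\<pi> \<one>\<^bsub>Rb\<^esub> = \<one>\<^bsub>K\<^esub>" using ring_hom_one[OF \<kappa>_hom] by simp
  qed
  show "\<pi> u = \<zero>\<^bsub>K\<^esub> \<longleftrightarrow> u \<in> max_ideal Rb" if u: "u \<in> carrier Rb" for u
  proof -
    obtain x where x: "x \<in> carrier R" "u = ?q x" using u unfolding surj by blast
    interpret iota: ring_hom_ring K R \<iota>
    proof (rule ring_hom_ringI2[OF K ring_axioms])
      show "\<iota> \<in> ring_hom K R"
        by (rule ring_hom_memI) (use ring_iso_memE[OF \<iota>] in \<open>auto\<close>)
    qed
    have "?\<kappa> (coef x) = \<zero>\<^bsub>K\<^esub> \<longleftrightarrow> coef x = \<zero>"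
      using \<kappa>[OF coef_props(1)[OF x(1)]] iota.hom_zero bij_betw_inv_into_left[OF bij iota.R.zero_closed] by metis
    also have "\<dots> \<longleftrightarrow> x \<in> m" using coef_m coef_zero_imp_m[OF x(1)] by blast
    finally show ?thesis unfolding max x(2) pi[OF x(1)] q_in[OF x(1)] .
  qed
  obtain x y z where xyz: "x \<in> m" "y \<in> m" "z \<in> m" "x \<otimes> (y \<otimes> z) \<noteq> \<zero>" using cube_nonzero by blast
  have "y \<notin> socle R"
    using socle_mult(1)[of y z] xyz m_carr by auto
  hence "?q y \<noteq> ?q \<zero>" using q_eq[OF m_carr[OF xyz(2)] zero_closed] xyz(2) by (simp add: a_minus_def)
  hence "?q y \<noteq> \<zero>\<^bsub>Rb\<^esub>" by simp
  thus "\<exists>x\<in>max_ideal Rb. x \<noteq> \<zero>\<^bsub>Rb\<^esub>" unfolding max using xyz(2) by blast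
qed

text \<open>Here \<open>p\<close> and \<open>q\<close> are the components of a map that identifies \<open>R\<close> modulo its socle with the fibre product
of \<open>A\<close> and \<open>B\<close>. Their kernels intersect in the socle, and add up to \<open>m\<close>: if \<open>p x\<close> is in \<open>mA\<close>, it is the
image of an element of the kernel of \<open>q\<close>, and the difference lies in the kernel of \<open>p\<close>.\<close>

lemma (in long_gorenstein_algebra) orthogonal_ideals_of_fibre_product:
  assumes p: "ring_hom_ring R A p" and q: "ring_hom_ring R B q"
    and A: "local_cring A mA" and B: "local_cring B mB" and K: "cring K"
    and f: "f \<in> ring_hom A K" "\<And>a. a \<in> carrier A \<Longrightarrow> f a = \<zero>\<^bsub>K\<^esub> \<longleftrightarrow> a \<in> mA"
    and g: "g \<in> ring_hom B K" "\<And>b. b \<in> carrier B \<Longrightarrow> g b = \<zero>\<^bsub>K\<^esub> \<longleftrightarrow> b \<in> mB"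
    and nzA: "\<exists>a\<in>mA. a \<noteq> \<zero>\<^bsub>A\<^esub>" and nzB: "\<exists>b\<in>mB. b \<noteq> \<zero>\<^bsub>B\<^esub>"
    and compat: "\<And>x. x \<in> carrier R \<Longrightarrow> f (p x) = g (q x)"
    and surj: "\<And>a b. a \<in> carrier A \<Longrightarrow> b \<in> carrier B \<Longrightarrow> f a = g b \<Longrightarrow> \<exists>x\<in>carrier R. p x = a \<and> q x = b"
    and ker: "\<And>x. x \<in> carrier R \<Longrightarrow> p x = \<zero>\<^bsub>A\<^esub> \<and> q x = \<zero>\<^bsub>B\<^esub> \<longleftrightarrow> x \<in> socle R"
  shows "\<exists>I J. orthogonal_ideals R m \<delta> k I J"
proof -
  interpret A: local_cring A mA by fact
  interpret B: local_cring B mB by fact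
  interpret K: cring K by fact
  interpret p: ring_hom_ring R A p by fact
  interpret q: ring_hom_ring R B q by fact
  interpret mA: ideal mA A by (rule A.m_ideal)
  interpret mB: ideal mB B by (rule B.m_ideal)
  interpret m: ideal m R by (rule m_ideal)
  interpret soc: ideal "socle R" R by (rule socle_ideal)
  let ?I = "a_kernel R B q" and ?J = "a_kernel R A p"
  interpret I: ideal ?I R by (rule q.kernel_is_ideal)
  interpret J: ideal ?J R by (rule p.kernel_is_ideal)
  have mem: "x \<in> ?I \<longleftrightarrow> x \<in> carrier R \<and> q x = \<zero>\<^bsub>B\<^esub>" "x \<in> ?J \<longleftrightarrow> x \<in> carrier R \<and> p x = \<zero>\<^bsub>A\<^esub>" for x
    unfolding a_kernel_def' by auto
  have inter: "?I \<inter> ?J = socle R"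
  proof (intro equalityI subsetI)
    fix x assume "x \<in> ?I \<inter> ?J"
    thus "x \<in> socle R" using ker[of x] unfolding Int_iff mem by blast
  next
    fix x assume "x \<in> socle R"
    thus "x \<in> ?I \<inter> ?J" using ker[of x] soc.Icarr[of x] unfolding Int_iff mem by blast
  qed
  have Im: "?I \<subseteq> m"
  proof (rule proper_ideal_in_m[OF I.is_ideal])
    show "\<one> \<notin> ?I" unfolding mem using B.one_notin_m mB.zero_closed q.hom_one by metis
  qed
  have Jm: "?J \<subseteq> m"
  proof (rule proper_ideal_in_m[OF J.is_ideal])
    show "\<one> \<notin> ?J" unfolding mem using A.one_notin_m mA.zero_closed p.hom_one by metis
  qed
  have f0: "f \<zero>\<^bsub>A\<^esub> = \<zero>\<^bsub>K\<^esub>" and g0: "g \<zero>\<^bsub>B\<^esub> = \<zero>\<^bsub>K\<^esub>"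
    using f(2)[of "\<zero>\<^bsub>A\<^esub>"] g(2)[of "\<zero>\<^bsub>B\<^esub>"] by simp_all
  have liftI: "\<exists>x\<in>?I. p x = a" if a: "a \<in> mA" for a
  proof -
    have "f a = g \<zero>\<^bsub>B\<^esub>" using f(2)[of a] a g0 by simp
    then obtain x where "x \<in> carrier R" "p x = a" "q x = \<zero>\<^bsub>B\<^esub>"
      using surj[of a "\<zero>\<^bsub>B\<^esub>"] a by auto
    thus ?thesis unfolding Bex_def mem by blast
  qed
  have liftJ: "\<exists>x\<in>?J. q x = b" if b: "b \<in> mB" for b
  proof -
    have "f \<zero>\<^bsub>A\<^esub> = g b" using g(2)[of b] b f0 by simp
    then obtain x where "x \<in> carrier R" "p x = \<zero>\<^bsub>A\<^esub>" "q x = b"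
      using surj[of "\<zero>\<^bsub>A\<^esub>" b] b by auto
    thus ?thesis unfolding Bex_def mem by blast
  qed
  have Isoc: "?I \<noteq> socle R"
  proof
    assume eq: "?I = socle R"
    obtain a where a: "a \<in> mA" "a \<noteq> \<zero>\<^bsub>A\<^esub>" using nzA by blast
    then obtain x where "x \<in> ?I" "p x = a" using liftI by blast
    moreover from this have "x \<in> ?J" using eq inter by blast
    ultimately show False using a(2) unfolding mem by simp
  qed
  have Jsoc: "?J \<noteq> socle R"
  proof
    assume eq: "?J = socle R"
    obtain b where b: "b \<in> mB" "b \<noteq> \<zero>\<^bsub>B\<^esub>" using nzB by blast
    then obtain x where "x \<in> ?J" "q x = b" using liftJ by blast
    moreover from this have "x \<in> ?I" using eq inter by blast
    ultimately show False using b(2) unfolding mem by simp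
  qed
  have sum: "\<exists>a\<in>?I. \<exists>b\<in>?J. x = a \<oplus> b" if x: "x \<in> m" for x
  proof -
    have xc: "x \<in> carrier R" using x by simp
    \<comment> \<open>Otherwise \<open>p x\<close> and \<open>q x\<close> are units with equal residues; so are their inverses, which therefore
        come from one element of \<open>R\<close>. It is an inverse of \<open>x\<close> modulo the socle, although \<open>x \<in> m\<close>.\<close>
    have pA: "p x \<in> mA"
    proof (rule ccontr)
      assume nA: "p x \<notin> mA"
      hence "f (p x) \<noteq> \<zero>\<^bsub>K\<^esub>" using f(2)[of "p x"] xc by simp
      hence nB: "q x \<notin> mB" using g(2)[of "q x"] compat[OF xc] xc by simp
      obtain a where a: "a \<in> carrier A" "p x \<otimes>\<^bsub>A\<^esub> a = \<one>\<^bsub>A\<^esub>" using A.unit_outside_m[OF _ nA] xc by auto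
      obtain b where b: "b \<in> carrier B" "q x \<otimes>\<^bsub>B\<^esub> b = \<one>\<^bsub>B\<^esub>" using B.unit_outside_m[OF _ nB] xc by auto
      let ?c = "f (p x)"
      have cab: "?c \<in> carrier K" "f a \<in> carrier K" "g b \<in> carrier K"
        using ring_hom_closed[OF f(1)] ring_hom_closed[OF g(1)] a(1) b(1) xc by auto
      have "?c \<otimes>\<^bsub>K\<^esub> f a = \<one>\<^bsub>K\<^esub>"
        using ring_hom_mult[OF f(1), of "p x" a] ring_hom_one[OF f(1)] a xc by simp
      moreover have "?c \<otimes>\<^bsub>K\<^esub> g b = \<one>\<^bsub>K\<^esub>"
        using ring_hom_mult[OF g(1), of "q x" b] ring_hom_one[OF g(1)] b xc compat[OF xc] by simp
      moreover have "f a \<otimes>\<^bsub>K\<^esub> (?c \<otimes>\<^bsub>K\<^esub> g b) = g b \<otimes>\<^bsub>K\<^esub> (?c \<otimes>\<^bsub>K\<^esub> f a)" using cab by algebra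
      ultimately have "f a = g b" using cab by simp
      then obtain y where y: "y \<in> carrier R" "p y = a" "q y = b" using surj[OF a(1) b(1)] by blast
      have "p (x \<otimes> y \<ominus> \<one>) = \<zero>\<^bsub>A\<^esub>" "q (x \<otimes> y \<ominus> \<one>) = \<zero>\<^bsub>B\<^esub>"
        unfolding a_minus_def using xc y a(2) b(2) by (simp_all add: A.r_neg B.r_neg)
      hence "x \<otimes> y \<ominus> \<one> \<in> m" using ker[of "x \<otimes> y \<ominus> \<one>"] xc y(1) socle_in_m by auto
      moreover have "\<one> = x \<otimes> y \<oplus> \<ominus> (x \<otimes> y \<ominus> \<one>)" using xc y(1) by algebra
      moreover have "x \<otimes> y \<in> m" by (rule m.I_r_closed[OF x y(1)])
      ultimately have "\<one> \<in> m" using m.a_closed m.a_inv_closed by metis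
      thus False using one_notin_m by simp
    qed
    obtain a where a: "a \<in> ?I" "p a = p x" using liftI[OF pA] by blast
    have ac: "a \<in> carrier R" by (rule I.Icarr[OF a(1)])
    have "p (x \<ominus> a) = \<zero>\<^bsub>A\<^esub>" unfolding a_minus_def using xc ac a(2) by (simp add: A.r_neg)
    hence "x \<ominus> a \<in> ?J" unfolding mem using xc ac by simp
    moreover have "x = a \<oplus> (x \<ominus> a)" using xc ac by algebra
    ultimately show ?thesis using a(1) by blast
  qed
  show ?thesis
    by (rule orthogonal_ideals_exist[OF I.is_ideal J.is_ideal inter sum Im Jm Isoc Jsoc])
qed

theorem proposition4p5:
  fixes K :: "'k ring"
    and Q :: "'q ring" and \<iota>\<^sub>Q :: "'k \<Rightarrow> 'q" and gr\<^sub>Q :: "nat \<Rightarrow> 'q set"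
    and R :: "'r ring" and \<iota>\<^sub>R :: "'k \<Rightarrow> 'r" and gr\<^sub>R :: "nat \<Rightarrow> 'r set"
    and S :: "'s ring" and \<iota>\<^sub>S :: "'k \<Rightarrow> 's" and gr\<^sub>S :: "nat \<Rightarrow> 's set"
  defines "Qb \<equiv> Q Quot (socle Q)" and "Rb \<equiv> R Quot (socle R)" and "Sb \<equiv> S Quot (socle S)"
  defines "\<pi>\<^sub>R \<equiv> residue_proj K Rb (quot_unit R (socle R) \<iota>\<^sub>R)"
    and "\<pi>\<^sub>S \<equiv> residue_proj K Sb (quot_unit S (socle S) \<iota>\<^sub>S)"
  assumes "field K"
    and "graded_algebra K Q \<iota>\<^sub>Q gr\<^sub>Q" and "gorenstein_artin_local Q"
    and "graded_algebra K R \<iota>\<^sub>R gr\<^sub>R" and "gorenstein_artin_local R"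
    and "graded_algebra K S \<iota>\<^sub>S gr\<^sub>S" and "gorenstein_artin_local S"
    and "loewy_length Q = loewy_length R" and "loewy_length R = loewy_length S"
    and "3 \<le> loewy_length Q"
    and "graded_ring_iso Qb (quot_grading Q (socle Q) gr\<^sub>Q)
           (fibre_product Rb \<pi>\<^sub>R Sb \<pi>\<^sub>S)
           (fibre_grading \<pi>\<^sub>R (quot_grading R (socle R) gr\<^sub>R) \<pi>\<^sub>S (quot_grading S (socle S) gr\<^sub>S))"
  shows "decomposes_as_connected_sum K Q"
proof -
  interpret K: field K by fact
  obtain \<delta>\<^sub>Q where "gorenstein_algebra Q (max_ideal Q) \<delta>\<^sub>Q (gr\<^sub>Q 0)"
    using graded_algebra.gorenstein_algebra_of_graded[OF \<open>graded_algebra K Q \<iota>\<^sub>Q gr\<^sub>Q\<close> \<open>gorenstein_artin_local Q\<close>] by blast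
  then interpret Q: long_gorenstein_algebra Q "max_ideal Q" \<delta>\<^sub>Q "gr\<^sub>Q 0"
    by (rule gorenstein_algebra.long_gorenstein_algebra) (use assms in simp)
  obtain \<delta>\<^sub>R where "gorenstein_algebra R (max_ideal R) \<delta>\<^sub>R (gr\<^sub>R 0)"
    using graded_algebra.gorenstein_algebra_of_graded[OF \<open>graded_algebra K R \<iota>\<^sub>R gr\<^sub>R\<close> \<open>gorenstein_artin_local R\<close>] by blast
  then interpret R: long_gorenstein_algebra R "max_ideal R" \<delta>\<^sub>R "gr\<^sub>R 0"
    by (rule gorenstein_algebra.long_gorenstein_algebra) (use assms in simp)
  obtain \<delta>\<^sub>S where "gorenstein_algebra S (max_ideal S) \<delta>\<^sub>S (gr\<^sub>S 0)"
    using graded_algebra.gorenstein_algebra_of_graded[OF \<open>graded_algebra K S \<iota>\<^sub>S gr\<^sub>S\<close> \<open>gorenstein_artin_local S\<close>] by blast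
  then interpret S: long_gorenstein_algebra S "max_ideal S" \<delta>\<^sub>S "gr\<^sub>S 0"
    by (rule gorenstein_algebra.long_gorenstein_algebra) (use assms in simp)
  note Rb = R.quotient_by_socle[OF graded_algebra.unit_iso[OF \<open>graded_algebra K R \<iota>\<^sub>R gr\<^sub>R\<close>] K.ring_axioms, folded Rb_def, folded \<pi>\<^sub>R_def]
  note Sb = S.quotient_by_socle[OF graded_algebra.unit_iso[OF \<open>graded_algebra K S \<iota>\<^sub>S gr\<^sub>S\<close>] K.ring_axioms, folded Sb_def, folded \<pi>\<^sub>S_def]
  interpret Rb: local_cring Rb "max_ideal Rb" by (rule Rb(1))
  interpret Sb: local_cring Sb "max_ideal Sb" by (rule Sb(1))
  let ?P = "fibre_product Rb \<pi>\<^sub>R Sb \<pi>\<^sub>S"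
  obtain \<phi> where \<phi>: "\<phi> \<in> ring_iso Qb ?P"
    using assms(16) unfolding graded_ring_iso_def by blast
  note \<phi>E = ring_iso_memE[OF \<phi>]
  interpret soc: ideal "socle Q" Q by (rule Q.socle_ideal)
  define q where "q = (+>\<^bsub>Q\<^esub>) (socle Q)"
  interpret q: ring_hom_cring Q Qb q
    unfolding Qb_def q_def by (rule soc.rcos_ring_hom_cring[OF Q.is_cring])
  have qsurj: "carrier Qb = q ` carrier Q"
    unfolding Qb_def q_def FactRing_def A_RCOSETS_def' by auto
  have pair: "fst (\<phi> (q x)) \<in> carrier Rb \<and> snd (\<phi> (q x)) \<in> carrier Sb \<and> \<pi>\<^sub>R (fst (\<phi> (q x))) = \<pi>\<^sub>S (snd (\<phi> (q x)))"
    if "x \<in> carrier Q" for x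
    using \<phi>E(1)[OF q.hom_closed[OF that]] unfolding fibre_product_simps(1) by auto
  have mult: "u \<otimes>\<^bsub>?P\<^esub> v = (fst u \<otimes>\<^bsub>Rb\<^esub> fst v, snd u \<otimes>\<^bsub>Sb\<^esub> snd v)"
    and add: "u \<oplus>\<^bsub>?P\<^esub> v = (fst u \<oplus>\<^bsub>Rb\<^esub> fst v, snd u \<oplus>\<^bsub>Sb\<^esub> snd v)" for u v
    by (metis fibre_product_simps(2) prod.collapse) (metis fibre_product_simps(3) prod.collapse)
  have p1: "ring_hom_ring Q Rb (\<lambda>x. fst (\<phi> (q x)))"
    by (rule ring_hom_ringI[OF Q.ring_axioms Rb.ring_axioms])
      (use pair \<phi>E in \<open>simp_all add: mult add fibre_product_simps(4)\<close>)
  have p2: "ring_hom_ring Q Sb (\<lambda>x. snd (\<phi> (q x)))"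
    by (rule ring_hom_ringI[OF Q.ring_axioms Sb.ring_axioms])
      (use pair \<phi>E in \<open>simp_all add: mult add fibre_product_simps(4)\<close>)
  interpret p1: ring_hom_ring Q Rb "\<lambda>x. fst (\<phi> (q x))" by (rule p1)
  interpret p2: ring_hom_ring Q Sb "\<lambda>x. snd (\<phi> (q x))" by (rule p2)
  have "\<exists>I J. orthogonal_ideals Q (max_ideal Q) \<delta>\<^sub>Q (gr\<^sub>Q 0) I J"
  proof (rule Q.orthogonal_ideals_of_fibre_product[OF p1 p2 Rb(1) Sb(1) K.is_cring Rb(2,3) Sb(2,3) Rb(4) Sb(4)])
    show "\<pi>\<^sub>R (fst (\<phi> (q x))) = \<pi>\<^sub>S (snd (\<phi> (q x)))" if "x \<in> carrier Q" for x
      using pair[OF that] by blast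
    show "\<exists>x\<in>carrier Q. fst (\<phi> (q x)) = a \<and> snd (\<phi> (q x)) = b"
      if "a \<in> carrier Rb" "b \<in> carrier Sb" "\<pi>\<^sub>R a = \<pi>\<^sub>S b" for a b
    proof -
      have "(a, b) \<in> carrier ?P" unfolding fibre_product_simps(1) using that by simp
      hence "(a, b) \<in> \<phi> ` q ` carrier Q" using \<phi>E(5) unfolding qsurj bij_betw_def by simp
      then obtain x where x: "x \<in> carrier Q" "\<phi> (q x) = (a, b)" by auto
      thus ?thesis by (intro bexI[of _ x]) simp_all
    qed
    show "fst (\<phi> (q x)) = \<zero>\<^bsub>Rb\<^esub> \<and> snd (\<phi> (q x)) = \<zero>\<^bsub>Sb\<^esub> \<longleftrightarrow> x \<in> socle Q"
      if x: "x \<in> carrier Q" for x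
    proof -
      have "fst (\<phi> (q x)) = \<zero>\<^bsub>Rb\<^esub> \<and> snd (\<phi> (q x)) = \<zero>\<^bsub>Sb\<^esub> \<longleftrightarrow> \<phi> (q x) = \<phi> (q \<zero>\<^bsub>Q\<^esub>)"
        using p1.hom_zero p2.hom_zero by (simp add: prod_eq_iff)
      also have "\<dots> \<longleftrightarrow> q x = q \<zero>\<^bsub>Q\<^esub>"
        by (rule inj_on_eq_iff[OF bij_betw_imp_inj_on[OF \<phi>E(5)] q.hom_closed[OF x] q.hom_closed[OF Q.zero_closed]])
      also have "\<dots> \<longleftrightarrow> x \<in> socle Q"
        using Q.quotient_eq_iff_same_a_r_cos[OF Q.socle_ideal x Q.zero_closed] x
        unfolding q_def by (simp add: a_minus_def)
      finally show ?thesis .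
    qed
  qed
  then obtain I J where IJ: "orthogonal_ideals Q (max_ideal Q) \<delta>\<^sub>Q (gr\<^sub>Q 0) I J" by blast
  show ?thesis
    by (rule decomposes_of_orthogonal_ideals[OF IJ K.ring_axioms ring_iso_set_sym[OF K.ring_axioms graded_algebra.unit_iso[OF \<open>graded_algebra K Q \<iota>\<^sub>Q gr\<^sub>Q\<close>]]])
qed

end
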